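(* Let $\alpha\in(0,1)$, $\theta>-\alpha$ and $x\in(0,1)$. Put $h(z)=\ln z-x\ln\bigl(1-(1-z)^{\alpha}\bigr)$ for $z\in(0,1)$, let $z(x)$ be the solution of $h'(z)=0$ in $(0,1)$, and let $I(x)=h(z(x))$. Let $K_n$ be the number of types in a sample of size $n$ from the Ewens-Pitman model with parameters $(\alpha,\theta)$. Then, as $n\to\infty$, $$ \mathbb{P}(K_n\geq xn)=\frac{\Gamma(\theta)}{\Gamma(\theta/\alpha)}\,\frac{n^{(\frac{1}{\alpha}-1)\theta-\frac{1}{2}}}{z(x)\sqrt{2\pi |h''(z(x))|}}\,x^{\frac{\theta}{\alpha}-1}\,\frac{e^{-\{nx\}I'(x)}}{1-e^{-I'(x)}}\,e^{-nI(x)}\left[1+O\Bigl(\frac{1}{x}\frac{1}{n}\Bigr)\right]. $$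
   Context: Ewens-Pitman model: for $\alpha\in(0,1)$, $\theta+\alpha>0$ and $n\ge1$, let $M_{ln}$ ($1\le l\le n$) be the number of types represented exactly $l$ times in a sample of size $n$, and $K_n=\sum_{l=1}^n M_{ln}$ the number of types. For nonnegative integers $m_1,\dots,m_n$ with $\sum_j m_j=k$ and $\sum_j j m_j=n$, $$\mathbb{P}(M_{1n}=m_1,\dots,M_{nn}=m_n,K_n=k)=n!\,\frac{\prod_{i=1}^{k}(\theta+(i-1)\alpha)}{(\theta)_{n\uparrow1}}\prod_{j=1}^n\left(\frac{(1-\alpha)_{j-1\uparrow1}}{j!}\right)^{m_j}\frac{1}{m_j!},$$ where $(a)_{m\uparrow1}=\Gamma(a+m)/\Gamma(a)=a(a+1)\cdots(a+m-1)$. At $\theta=0$ the common factor $\theta$ in numerator and denominator is cancelled, and $\Gamma(\theta)/\Gamma(\theta/\alpha)$ is read as its limit $1/\alpha$. Notation: $\{u\}=\lceil u\rceil-u$. The function $h$ depends on $x$; $h''$ is its second derivative in $z$ with $x$ fixed; $h'(z)=0$ has exactly one root in $(0,1)$. $I'$ is the derivative of $x\mapsto I(x)=h(z(x))$. The notation $a_n=b_n(1+O(c_n))$ means $\left|\frac{a_n}{b_n}-1\right|\le M|c_n|$ with $M<\infty$ independent of $n$. *)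

theory Defs
  imports "HOL-Probability.Probability"
begin

text \<open>A sample of size \<open>n\<close> is a function \<open>s\<close> of which only the values \<open>s 1, \<dots>, s n\<close>
  (the types of the individuals) matter.\<close>

definition type_mult :: "nat \<Rightarrow> (nat \<Rightarrow> 'c) \<Rightarrow> nat \<Rightarrow> nat" where
  "type_mult n s l = card {c. card {i \<in> {1..n}. s i = c} = l}"

definition num_types :: "nat \<Rightarrow> (nat \<Rightarrow> 'c) \<Rightarrow> nat" where
  "num_types n s = (\<Sum>l=1..n. type_mult n s l)"

text \<open>The factor \<open>(\<Prod>i=1..k. \<theta> + (i - 1) \<alpha>) / (\<theta> (\<theta> + 1) \<dots> (\<theta> + n - 1))\<close>; for \<open>\<theta> = 0\<close> the
  common factor \<open>\<theta>\<close> of numerator and denominator is cancelled.\<close>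

definition ep_ratio :: "real \<Rightarrow> real \<Rightarrow> nat \<Rightarrow> nat \<Rightarrow> real" where
  "ep_ratio \<alpha> \<theta> n k =
     (if \<theta> = 0 then (\<Prod>i=2..k. \<theta> + (real i - 1) * \<alpha>) / pochhammer (\<theta> + 1) (n - 1)
      else (\<Prod>i=1..k. \<theta> + (real i - 1) * \<alpha>) / pochhammer \<theta> n)"

definition ep_prob :: "real \<Rightarrow> real \<Rightarrow> nat \<Rightarrow> (nat \<Rightarrow> nat) \<Rightarrow> nat \<Rightarrow> real" where
  "ep_prob \<alpha> \<theta> n m k =
     fact n * ep_ratio \<alpha> \<theta> n k *
     (\<Prod>j=1..n. (pochhammer (1 - \<alpha>) (j - 1) / fact j) ^ m j * (1 / fact (m j)))"

definition ewens_pitman_sample ::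
    "real \<Rightarrow> real \<Rightarrow> nat \<Rightarrow> 'w measure \<Rightarrow> (nat \<Rightarrow> 'w \<Rightarrow> 'c) \<Rightarrow> bool" where
  "ewens_pitman_sample \<alpha> \<theta> n P X \<longleftrightarrow>
     prob_space P \<and>
     (\<forall>l\<in>{1..n}. (\<lambda>\<omega>. type_mult n (\<lambda>i. X i \<omega>) l) \<in> measurable P (count_space UNIV)) \<and>
     (\<forall>m k. (\<Sum>j=1..n. m j) = k \<and> (\<Sum>j=1..n. j * m j) = n \<longrightarrow>
        measure P {\<omega> \<in> space P. (\<forall>l\<in>{1..n}. type_mult n (\<lambda>i. X i \<omega>) l = m l) \<and>
                                num_types n (\<lambda>i. X i \<omega>) = k}
        = ep_prob \<alpha> \<theta> n m k)"

definition h :: "real \<Rightarrow> real \<Rightarrow> real \<Rightarrow> real" where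
  "h \<alpha> x z = ln z - x * ln (1 - (1 - z) powr \<alpha>)"

definition z_root :: "real \<Rightarrow> real \<Rightarrow> real" where
  "z_root \<alpha> x = (THE z. 0 < z \<and> z < 1 \<and> deriv (h \<alpha> x) z = 0)"

definition rate :: "real \<Rightarrow> real \<Rightarrow> real" where
  "rate \<alpha> x = h \<alpha> x (z_root \<alpha> x)"

text \<open>\<open>\<Gamma>(\<theta>) / \<Gamma>(\<theta>/\<alpha>)\<close>, with its limit as \<open>\<theta> \<rightarrow> 0\<close> at \<open>\<theta> = 0\<close>, where both Gamma functions have a pole.\<close>

definition Gamma_ratio :: "real \<Rightarrow> real \<Rightarrow> real" where
  "Gamma_ratio \<alpha> \<theta> = (if \<theta> = 0 then 1 / \<alpha> else Gamma \<theta> / Gamma (\<theta> / \<alpha>))"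

text \<open>The distance up to the next integer, not the usual fractional part \<open>frac\<close>.\<close>

definition ceil_frac :: "real \<Rightarrow> real" where
  "ceil_frac u = of_int \<lceil>u\<rceil> - u"

definition tail_approx :: "real \<Rightarrow> real \<Rightarrow> real \<Rightarrow> nat \<Rightarrow> real" where
  "tail_approx \<alpha> \<theta> x n =
     Gamma_ratio \<alpha> \<theta> *
     (real n powr ((1 / \<alpha> - 1) * \<theta> - 1 / 2) /
       (z_root \<alpha> x * sqrt (2 * pi * \<bar>deriv (deriv (h \<alpha> x)) (z_root \<alpha> x)\<bar>))) *
     x powr (\<theta> / \<alpha> - 1) *
     (exp (- ceil_frac (real n * x) * deriv (rate \<alpha>) x) / (1 - exp (- deriv (rate \<alpha>) x))) *
     exp (- real n * rate \<alpha> x)"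

end

theory Submission
  imports Defs "HOL-Real_Asymp.Real_Asymp"
begin

text \<open>
  Write \<open>F(t) = 1 - (1 - t)\<^sup>\<alpha>\<close>. With rising factorials \<open>(a)\<^sub>m\<close>, the weights
  \<open>p\<^sub>j = \<alpha> (1 - \<alpha>)\<^sub>j\<^sub>-\<^sub>1 / j!\<close> behind the Ewens-Pitman formula are the Taylor coefficients of \<open>F\<close>; they are nonnegative and sum to 1, and the law they define is
  the Sibuya law. Summing the formula over all partitions of \<open>n\<close> into \<open>k\<close> parts gives
  \<open>P(K\<^sub>n = k) = W(n,k) \<cdot> [t^n] F(t)^k\<close>, where \<open>W(n,k)\<close> is the quotient of \<open>(\<theta>/\<alpha>)\<^sub>k / k!\<close> and
  \<open>(\<theta>)\<^sub>n / n!\<close> (\<open>measure_num_types_ge\<close>). By the product formula for the Gamma function with an error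
  term, \<open>W(n,k)\<close> is \<open>\<Gamma>(\<theta>)/\<Gamma>(\<theta>/\<alpha>) \<cdot> k powr (\<theta>/\<alpha> - 1) \<cdot> n powr (1 - \<theta>)\<close> up to a factor
  \<open>1 + O(1/k + 1/n)\<close>, with \<open>1/\<alpha>\<close> in place of the Gamma quotient for \<open>\<theta> = 0\<close> (\<open>types_weight_asymp\<close>).

  The coefficient \<open>[t^n] F(t)^k\<close> is the probability that \<open>k\<close> independent Sibuya variables have sum \<open>n\<close>.
  Give the value \<open>j\<close> the new probability \<open>p\<^sub>j z^j / F(z)\<close>, where \<open>z = z(x)\<close>. Then
  \<open>[t^n] F(t)^k = F(z)^k z^(-n) q\<^sub>k(n)\<close>, where \<open>q\<^sub>k\<close> is the law of the sum of \<open>k\<close> tilted variables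
  (\<open>conv_pow_tilted\<close>). The equation \<open>h'(z) = 0\<close> says that the tilted mean is \<open>1/x\<close>. So for \<open>k\<close> near
  \<open>xn\<close> the value \<open>n\<close> is close to the mean \<open>k/x\<close> of \<open>q\<^sub>k\<close>, and a local limit theorem
  (\<open>local_limit\<close>) gives \<open>q\<^sub>k(n) = 1 / sqrt (2 \<pi> k v) + O((1 + \<bar>k/x - n\<bar>)\<^sup>2 k powr (-3/2))\<close> with the
  tilted variance \<open>v\<close>.

  The tilt at the single point \<open>z(x)\<close> is good enough for every \<open>k \<ge> xn\<close>: in the sum over \<open>k\<close> the factor
  \<open>F(z)^k\<close> decays geometrically, and this absorbs errors that are polynomial in \<open>k - xn\<close>. What
  remains is the geometric series \<open>F(z)^\<lceil>xn\<rceil> / (1 - F(z))\<close> (\<open>geometric_average_error\<close>).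
  The identities that bring the result into the stated form are \<open>x v = z\<^sup>2 \<bar>h''(z)\<bar>\<close>, because \<open>h'(z)\<close>
  equals \<open>1 - x \<cdot> (tilted mean)\<close> divided by \<open>z\<close> and the tilted mean has derivative \<open>v/z\<close>, and
  \<open>I'(x) = - ln F(z(x))\<close>, because \<open>I\<close> is an upper envelope of functions that are affine in \<open>x\<close>
  (\<open>DERIV_rate\<close>).
\<close>

section \<open>A local limit theorem for laws on the natural numbers\<close>

text \<open>For probability weights \<open>w\<close> this is the law of a sum of \<open>k\<close> independent variables with law \<open>w\<close>.\<close>

definition conv_pow :: "(nat \<Rightarrow> real) \<Rightarrow> nat \<Rightarrow> nat \<Rightarrow> real" where
  "conv_pow w k n = fps_nth (Abs_fps w ^ k) n"

lemma conv_pow_0: "conv_pow w 0 n = (if n = 0 then 1 else 0)"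
  by (simp add: conv_pow_def)

lemma conv_pow_Suc: "conv_pow w (Suc k) n = (\<Sum>i\<le>n. w i * conv_pow w k (n - i))"
  by (simp add: conv_pow_def fps_mult_nth atLeast0AtMost)

lemma conv_pow_nonneg: "(\<And>m. 0 \<le> w m) \<Longrightarrow> 0 \<le> conv_pow w k n"
  by (induction k arbitrary: n) (auto simp: conv_pow_0 conv_pow_Suc intro!: sum_nonneg)

text \<open>Up to \<open>t = 3\<close> the Taylor polynomial of degree 4 suffices; from there to \<open>\<pi>\<close> the cosine
  decreases, and \<open>\<pi> < 4\<close>.\<close>

lemma one_minus_cos_ge:
  fixes t :: real
  assumes "\<bar>t\<bar> \<le> pi"
  shows "t\<^sup>2 / 16 \<le> 1 - cos t"
proof -
  have taylor: "1 - cos s \<ge> s\<^sup>2 / 2 - s ^ 4 / 24" for s :: real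
  proof -
    obtain u where "cos s = (\<Sum>m<4. cos_coeff m * s ^ m) + (cos (u + 1/2 * real 4 * pi) / fact 4) * s ^ 4"
      using Maclaurin_cos_expansion[of s 4] by blast
    moreover have "(\<Sum>m<4. cos_coeff m * s ^ m) = 1 - s\<^sup>2 / 2"
    proof -
      have "{..<4::nat} = {0, 1, 2, 3}" by auto
      thus ?thesis by (simp add: cos_coeff_def)
    qed
    moreover have "cos (u + 1/2 * real 4 * pi) / fact 4 * s ^ 4 \<le> 1 / 24 * s ^ 4"
      by (intro mult_right_mono) (auto simp: fact_numeral)
    ultimately show ?thesis by simp
  qed
  have *: "s\<^sup>2 / 16 \<le> 1 - cos s" if s: "0 \<le> s" "s \<le> pi" for s
  proof (cases "s \<le> 3")
    case True
    have "s\<^sup>2 \<le> 3\<^sup>2" using True s by (intro power_mono) auto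
    hence "s\<^sup>2 * s\<^sup>2 \<le> s\<^sup>2 * 9" by (intro mult_left_mono) auto
    hence "s ^ 4 \<le> 9 * s\<^sup>2" by (simp add: power2_eq_square power4_eq_xxxx mult_ac)
    with taylor[of s] show ?thesis using zero_le_power2[of s] by linarith
  next
    case False
    have "cos s \<le> cos 3" using False s by (intro cos_monotone_0_pi_le) auto
    moreover have "1 - cos 3 \<ge> (9/8 :: real)" using taylor[of 3] by simp
    moreover have "s\<^sup>2 \<le> 4\<^sup>2" using pi_less_4 s by (intro power_mono) auto
    ultimately show ?thesis by simp
  qed
  show ?thesis using *[of "\<bar>t\<bar>"] assms by simp
qed

lemma abs_exp_minus_linear_le:
  fixes u :: real
  assumes "0 \<le> u"
  shows "\<bar>exp (- u) - (1 - u)\<bar> \<le> u\<^sup>2"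
proof -
  have "1 - u \<le> exp (- u)" using exp_ge_add_one_self[of "- u"] by simp
  moreover have "exp (- u) \<le> 1 / (1 + u)"
    using exp_ge_add_one_self[of u] assms by (simp add: exp_minus field_simps)
  moreover have "1 / (1 + u) \<le> 1 - u + u\<^sup>2"
  proof -
    have "1 \<le> (1 - u + u\<^sup>2) * (1 + u)" using assms by (simp add: algebra_simps power2_eq_square)
    thus ?thesis using assms by (simp add: field_simps)
  qed
  ultimately show ?thesis by simp
qed

text \<open>Used with the characteristic function for \<open>a\<close> and its Gaussian approximation for \<open>b\<close>. The
  linear term is kept apart because its leading part will be purely imaginary and so does not
  contribute; the rest is quadratic in \<open>a - b\<close>.\<close>

lemma power_diff_linear_bound:
  fixes a b :: complex and E :: real
  assumes "norm a \<le> E" "norm b \<le> E" "E > 0"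
  shows "norm (a ^ k - b ^ k - of_nat k * b ^ (k - 1) * (a - b)) \<le> (real k)\<^sup>2 * (E ^ k / E\<^sup>2) * (norm (a - b))\<^sup>2"
proof (induction k)
  case 0
  then show ?case by simp
next
  case (Suc k)
  define D where "D k = a ^ k - b ^ k - of_nat k * b ^ (k - 1) * (a - b)" for k
  have D: "D (Suc k) = a * D k + of_nat k * b ^ (k - 1) * (a - b)\<^sup>2"
    by (cases k) (simp_all add: D_def algebra_simps power2_eq_square)
  have b: "real k * norm b ^ (k - 1) \<le> real k * (E ^ Suc k / E\<^sup>2)"
  proof (cases k)
    case (Suc j)
    have "norm b ^ j \<le> E ^ j" using assms by (intro power_mono) auto
    moreover have "E ^ Suc k / E\<^sup>2 = E ^ j" using Suc assms by (simp add: power2_eq_square)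
    ultimately show ?thesis using Suc by (intro mult_left_mono) auto
  qed simp
  have "norm (D (Suc k)) \<le> norm a * norm (D k) + real k * norm b ^ (k - 1) * (norm (a - b))\<^sup>2"
    unfolding D by (rule order_trans[OF norm_triangle_ineq]) (simp add: norm_mult norm_power)
  also have "\<dots> \<le> E * ((real k)\<^sup>2 * (E ^ k / E\<^sup>2) * (norm (a - b))\<^sup>2)
                + real k * (E ^ Suc k / E\<^sup>2) * (norm (a - b))\<^sup>2"
    using Suc.IH assms unfolding D_def[symmetric]
    by (intro add_mono mult_mono mult_right_mono[OF b]) auto
  also have "\<dots> = ((real k)\<^sup>2 + real k) * ((E ^ Suc k / E\<^sup>2) * (norm (a - b))\<^sup>2)"
    by (simp add: algebra_simps add_divide_distrib)
  also have "\<dots> \<le> (real (Suc k))\<^sup>2 * ((E ^ Suc k / E\<^sup>2) * (norm (a - b))\<^sup>2)"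
    using assms by (intro mult_right_mono) (auto simp: power2_eq_square algebra_simps)
  finally show ?case by (simp add: D_def mult_ac)
qed

lemma has_integral_even_gaussian:
  fixes c :: real
  assumes "c > 0"
  shows "((\<lambda>t. t ^ (2 * m) * exp (- c * t\<^sup>2)) has_integral
           sqrt (pi / c) * (fact (2 * m) / ((4 * c) ^ m * fact m))) UNIV"
proof -
  define s where "s = sqrt (1 / (2 * c))"
  have s2: "s\<^sup>2 = 1 / (2 * c)" using assms by (simp add: s_def)
  have "has_bochner_integral lborel (\<lambda>t. normal_density 0 s t * (t - 0) ^ (2 * m))
          (fact (2 * m) / ((2 / s\<^sup>2) ^ m * fact m))"
    by (rule normal_moment_even) (use assms in \<open>simp add: s_def\<close>)
  hence "((\<lambda>t. normal_density 0 s t * t ^ (2 * m)) has_integral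
          (fact (2 * m) / ((4 * c) ^ m * fact m))) UNIV"
    using has_integral_integral_lborel[of "\<lambda>t. normal_density 0 s t * t ^ (2 * m)"] s2
    by (simp add: has_bochner_integral_iff)
  from has_integral_mult_right[OF this, of "sqrt (pi / c)"]
  have "((\<lambda>t. sqrt (pi / c) * (normal_density 0 s t * t ^ (2 * m))) has_integral
          sqrt (pi / c) * (fact (2 * m) / ((4 * c) ^ m * fact m))) UNIV" .
  moreover have "sqrt (pi / c) * (normal_density 0 s t * t ^ (2 * m)) = t ^ (2 * m) * exp (- c * t\<^sup>2)" for t
  proof -
    have "normal_density 0 s t = 1 / sqrt (pi / c) * exp (- c * t\<^sup>2)"
      unfolding normal_density_def s2 by (simp add: field_simps)
    moreover have "sqrt (pi / c) \<noteq> 0" using assms by simp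
    ultimately show ?thesis by (simp add: field_simps)
  qed
  ultimately show ?thesis by simp
qed

text \<open>Atoms at the neighbouring points 1 and 2 exclude laws that live on a coarser lattice, for which
  no local limit theorem of this form holds. The fourth moment controls the error term.\<close>

locale lattice_law =
  fixes w :: "nat \<Rightarrow> real" and \<mu> v :: real
  assumes nonneg: "\<And>m. 0 \<le> w m"
    and total: "w sums 1"
    and pos1: "0 < w 1" and pos2: "0 < w 2"
    and mean: "(\<lambda>m. real m * w m) sums \<mu>"
    and var: "(\<lambda>m. (real m - \<mu>)\<^sup>2 * w m) sums v"
    and fourth: "summable (\<lambda>m. (real m - \<mu>) ^ 4 * w m)"
begin

definition cf :: "real \<Rightarrow> complex" where
  "cf t = (\<Sum>m. of_real (w m) * cis (real m * t))"

lemma summable_norm_w: "summable (\<lambda>m. norm (of_real (w m) * cis (y m)))"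
  using total nonneg by (simp add: norm_mult sums_iff)

lemma cf_sums: "(\<lambda>m. of_real (w m) * cis (real m * t)) sums cf t"
  unfolding cf_def by (intro summable_sums summable_norm_cancel[OF summable_norm_w])

lemma conv_pow_sums: "conv_pow w k sums 1"
proof (induction k)
  case 0
  show ?case using sums_single[of 0 "\<lambda>_. 1::real"] by (simp add: conv_pow_0[abs_def])
next
  case (Suc k)
  have "summable (\<lambda>m. norm (w m))" using total nonneg by (simp add: sums_iff)
  moreover have "summable (\<lambda>m. norm (conv_pow w k m))"
    using Suc conv_pow_nonneg[of w k] nonneg by (simp add: sums_iff)
  ultimately have "(\<lambda>n. \<Sum>i\<le>n. w i * conv_pow w k (n - i)) sums (suminf w * suminf (conv_pow w k))"
    by (rule Cauchy_product_sums)
  thus ?case using total Suc by (simp add: sums_iff conv_pow_Suc[abs_def])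
qed

lemma cf_power_sums: "(\<lambda>n. of_real (conv_pow w k n) * cis (real n * t)) sums (cf t ^ k)"
proof (induction k)
  case 0
  have "(\<lambda>n. of_real (conv_pow w 0 n) * cis (real n * t)) = (\<lambda>n. if n = 0 then 1 else 0)"
    by (auto simp: conv_pow_0)
  thus ?case using sums_single[of 0 "\<lambda>_. 1::complex"] by simp
next
  case (Suc k)
  have "summable (\<lambda>n. norm (of_real (conv_pow w k n) * cis (real n * t)))"
    using conv_pow_sums[of k] conv_pow_nonneg[of w k] nonneg by (simp add: norm_mult sums_iff)
  from Cauchy_product_sums[OF summable_norm_w this, of "\<lambda>m. real m * t"]
  have "(\<lambda>n. \<Sum>i\<le>n. (of_real (w i) * cis (real i * t)) *
          (of_real (conv_pow w k (n - i)) * cis (real (n - i) * t))) sums (cf t * cf t ^ k)"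
    using Suc cf_sums[of t] by (simp add: sums_iff)
  moreover have "(\<Sum>i\<le>n. (of_real (w i) * cis (real i * t)) *
          (of_real (conv_pow w k (n - i)) * cis (real (n - i) * t)))
      = of_real (conv_pow w (Suc k) n) * cis (real n * t)" for n
  proof -
    have "(of_real (w i) * cis (real i * t)) *
          (of_real (conv_pow w k (n - i)) * cis (real (n - i) * t))
        = of_real (w i * conv_pow w k (n - i)) * cis (real n * t)" if "i \<le> n" for i
    proof -
      have "cis (real i * t) * cis (real (n - i) * t) = cis (real n * t)"
        using that by (simp add: cis_mult of_nat_diff algebra_simps)
      thus ?thesis by (simp add: mult_ac)
    qed
    thus ?thesis unfolding conv_pow_Suc of_real_sum sum_distrib_right
      by (intro sum.cong) auto
  qed
  ultimately show ?case by simp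
qed

text \<open>The power of the characteristic function is an absolutely and uniformly convergent Fourier series,
  so it may be integrated term by term, and orthogonality of the cosines leaves the \<open>n\<close>-th term.\<close>

lemma cf_fourier_inversion:
  "((\<lambda>t. Re (cf t ^ k * cis (- real n * t))) has_integral 2 * pi * conv_pow w k n) {-pi..pi}"
proof -
  define g where "g m t = conv_pow w k m * cos ((real m - real n) * t)" for m t
  have sums: "(\<lambda>m. g m t) sums Re (cf t ^ k * cis (- real n * t))" for t
  proof -
    have "(\<lambda>m. Re (of_real (conv_pow w k m) * cis (real m * t) * cis (- real n * t))) sums
            Re (cf t ^ k * cis (- real n * t))"
      by (intro sums_Re sums_mult2 cf_power_sums)
    moreover have "Re (of_real (conv_pow w k m) * cis (real m * t) * cis (- real n * t)) = g m t" for m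
      by (simp add: mult.assoc cis_mult g_def left_diff_distrib)
    ultimately show ?thesis by simp
  qed
  have unif: "uniform_limit {-pi..pi} (\<lambda>N t. \<Sum>m<N. g m t) (\<lambda>t. \<Sum>m. g m t) sequentially"
  proof (rule Weierstrass_m_test)
    show "summable (conv_pow w k)" using conv_pow_sums by (simp add: sums_iff)
    show "norm (g m t) \<le> conv_pow w k m" for m t
      using conv_pow_nonneg[of w k m] nonneg by (simp add: g_def abs_mult mult_left_le)
  qed
  have lim: "(\<lambda>t. \<Sum>m. g m t) = (\<lambda>t. Re (cf t ^ k * cis (- real n * t)))"
    using sums by (auto simp: sums_iff)
  have cont: "continuous_on {-pi..pi} (\<lambda>t. \<Sum>m<N. g m t)" for N
    unfolding g_def by (intro continuous_intros)
  obtain I J where IJ: "\<And>N. ((\<lambda>t. \<Sum>m<N. g m t) has_integral I N) {-pi..pi}"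
      "((\<lambda>t. Re (cf t ^ k * cis (- real n * t))) has_integral J) {-pi..pi}" "I \<longlonglongrightarrow> J"
    using uniform_limit_integral[OF unif[unfolded lim] cont sequentially_bot] by blast
  have orth: "(g m has_integral (if m = n then 2 * pi * conv_pow w k n else 0)) {-pi..pi}" for m
  proof (cases "m = n")
    case True
    then show ?thesis
      using has_integral_const_real[of "conv_pow w k n" "-pi" pi] by (simp add: g_def[abs_def])
  next
    case False
    define d where "d = real m - real n"
    have d: "d \<noteq> 0" using False by (simp add: d_def)
    have "sin (d * pi) = 0"
      using sin_npi_int[of "int m - int n"] by (simp add: d_def mult.commute)
    moreover have "((\<lambda>t. cos (d * t)) has_integral (sin (d * pi) / d - sin (d * (-pi)) / d)) {-pi..pi}"
      by (rule fundamental_theorem_of_calculus)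
         (use d in \<open>auto intro!: derivative_eq_intros simp flip: has_real_derivative_iff_has_vector_derivative\<close>)
    ultimately have "((\<lambda>t. cos (d * t)) has_integral 0) {-pi..pi}" by simp
    from has_integral_mult_right[OF this, of "conv_pow w k m"] False
    show ?thesis by (simp add: g_def[abs_def] d_def)
  qed
  have "I N = 2 * pi * conv_pow w k n" if "N > n" for N
  proof -
    have "((\<lambda>t. \<Sum>m<N. g m t) has_integral (\<Sum>m<N. if m = n then 2 * pi * conv_pow w k n else 0)) {-pi..pi}"
      by (intro has_integral_sum orth) auto
    with IJ(1)[of N] have "I N = (\<Sum>m<N. if m = n then 2 * pi * conv_pow w k n else 0)"
      by (rule has_integral_unique)
    thus ?thesis using that by simp
  qed
  hence "I \<longlonglongrightarrow> 2 * pi * conv_pow w k n"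
    by (intro tendsto_eventually) (auto intro: eventually_mono[OF eventually_gt_at_top[of n]])
  with IJ show ?thesis using LIMSEQ_unique by blast
qed

lemma variance_pos: "0 < v"
proof -
  have le: "(\<Sum>m\<in>{1,2}. (real m - \<mu>)\<^sup>2 * w m) \<le> v"
    using var nonneg sum_le_suminf[of "\<lambda>m. (real m - \<mu>)\<^sup>2 * w m" "{1,2}"]
    by (simp add: sums_iff)
  have "0 < (1 - \<mu>)\<^sup>2 * w 1 + (2 - \<mu>)\<^sup>2 * w 2"
  proof (cases "\<mu> = 1")
    case True
    then show ?thesis using pos2 by simp
  next
    case False
    then show ?thesis using pos1 pos2 by (intro add_pos_nonneg mult_pos_pos mult_nonneg_nonneg) auto
  qed
  with le show ?thesis by simp
qed

text \<open>The two atoms alone force the decay: by the law of cosines, their joint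
  contribution falls short of \<open>w 1 + w 2\<close> by a multiple of \<open>1 - cos t\<close>, and the other atoms contribute at most
  \<open>1 - w 1 - w 2\<close>.\<close>

lemma cf_decay: "\<exists>c>0. \<forall>t. \<bar>t\<bar> \<le> pi \<longrightarrow> norm (cf t) \<le> exp (- c * t\<^sup>2)"
proof -
  define A where "A = w 1 + w 2"
  define c0 where "c0 = w 1 * w 2 / A"
  have A: "A > 0" and c0: "c0 > 0" using pos1 pos2 by (auto simp: A_def c0_def)
  have "norm (cf t) \<le> exp (- (c0 / 16) * t\<^sup>2)" if t: "\<bar>t\<bar> \<le> pi" for t
  proof -
    define g where "g m = (if m \<in> {1,2} then w m else 0)" for m :: nat
    have g1: "(\<lambda>m. of_real (g m) * cis (real m * t)) sums (of_real (w 1) * cis t + of_real (w 2) * cis (2 * t))"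
      using sums_If_finite_set[of "{1,2::nat}" "\<lambda>m. of_real (w m) * cis (real m * t)"]
      by (auto simp: g_def if_distrib[of of_real] if_distrib[of "\<lambda>x. x * _"] cong: if_cong)
    have g2: "g sums A"
      using sums_If_finite_set[of "{1,2::nat}" w] by (simp add: g_def[abs_def] A_def)
    have rest: "(\<lambda>m. w m - g m) sums (1 - A)" by (intro sums_diff total g2)
    have "norm (cf t - (of_real (w 1) * cis t + of_real (w 2) * cis (2 * t))) \<le> 1 - A"
    proof -
      have "(\<lambda>m. of_real (w m) * cis (real m * t) - of_real (g m) * cis (real m * t)) sums
            (cf t - (of_real (w 1) * cis t + of_real (w 2) * cis (2 * t)))"
        by (intro sums_diff cf_sums g1)
      hence "(\<lambda>m. of_real (w m - g m) * cis (real m * t)) sums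
            (cf t - (of_real (w 1) * cis t + of_real (w 2) * cis (2 * t)))"
        by (simp add: algebra_simps)
      moreover have "norm (of_real (w m - g m) * cis (real m * t)) \<le> w m - g m" for m
        using nonneg[of m] by (simp add: norm_mult g_def flip: of_real_diff)
      ultimately show ?thesis
        using norm_suminf_le[of "\<lambda>m. of_real (w m - g m) * cis (real m * t)" "\<lambda>m. w m - g m"] rest
        by (simp add: sums_iff)
    qed
    moreover have "norm (of_real (w 1) * cis t + of_real (w 2) * cis (2 * t)) \<le> A - c0 * (1 - cos t)"
    proof (rule power2_le_imp_le)
      have "of_real (w 1) * cis t + of_real (w 2) * cis (2 * t)
            = cis t * (of_real (w 1) + of_real (w 2) * cis t)"
        by (simp add: algebra_simps cis_mult)
      hence "(norm (of_real (w 1) * cis t + of_real (w 2) * cis (2 * t)))\<^sup>2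
              = (norm (of_real (w 1) + of_real (w 2) * cis t))\<^sup>2"
        by (simp add: norm_mult)
      also have "\<dots> = (w 1 + w 2 * cos t)\<^sup>2 + (w 2 * sin t)\<^sup>2"
        by (simp add: cmod_power2)
      also have "\<dots> = (w 1)\<^sup>2 + 2 * w 1 * w 2 * cos t + (w 2)\<^sup>2 * ((sin t)\<^sup>2 + (cos t)\<^sup>2)"
        by (simp only: power2_sum power_mult_distrib ring_distribs mult_ac add_ac)
      also have "\<dots> = A\<^sup>2 - 2 * A * (c0 * (1 - cos t))"
        using A by (simp add: A_def c0_def power2_eq_square field_simps)
      also have "\<dots> \<le> (A - c0 * (1 - cos t))\<^sup>2"
        by (simp add: power2_diff)
      finally show "(norm (of_real (w 1) * cis t + of_real (w 2) * cis (2 * t)))\<^sup>2 \<le> (A - c0 * (1 - cos t))\<^sup>2" .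
      have "c0 * (1 - cos t) \<le> c0 * 2"
        using c0 cos_ge_minus_one[of t] by (intro mult_left_mono) linarith+
      also have "\<dots> \<le> A"
      proof -
        have "0 \<le> (w 1)\<^sup>2 + (w 2)\<^sup>2" by simp
        hence "2 * (w 1 * w 2) \<le> A * A" by (simp add: A_def power2_eq_square algebra_simps)
        thus ?thesis using A by (simp add: c0_def field_simps)
      qed
      finally show "0 \<le> A - c0 * (1 - cos t)" by simp
    qed
    ultimately have "norm (cf t) \<le> 1 - c0 * (1 - cos t)"
      using norm_triangle_sub[of "cf t" "of_real (w 1) * cis t + of_real (w 2) * cis (2 * t)"] by linarith
    also have "\<dots> \<le> 1 - c0 * (t\<^sup>2 / 16)"
      using one_minus_cos_ge[OF t] c0 by simp
    also have "\<dots> \<le> exp (- (c0 / 16) * t\<^sup>2)"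
      using exp_ge_add_one_self[of "- (c0 / 16) * t\<^sup>2"] by simp
    finally show ?thesis .
  qed
  with c0 show ?thesis by (intro exI[of _ "c0 / 16"]) auto
qed

text \<open>The cubic term is displayed and not estimated: an error of order \<open>\<bar>t\<bar>\<^sup>3\<close> would cost a factor
  \<open>k powr (1/2)\<close> in the local limit theorem, but this term is purely imaginary and will drop out.\<close>

lemma centred_cf_expansion:
  "\<exists>\<kappa> C. \<forall>t. \<bar>t\<bar> \<le> pi \<longrightarrow> norm (cis (- \<mu> * t) * cf t - of_real (exp (- v * t\<^sup>2 / 2)) + \<i> * of_real (\<kappa> * t ^ 3)) \<le> C * t ^ 4"
proof -
  define y where "y m = real m - \<mu>" for m
  have fourth': "summable (\<lambda>m. y m ^ 4 * w m)" using fourth by (simp add: y_def)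
  have third: "summable (\<lambda>m. y m ^ 3 * w m)"
  proof (rule summable_comparison_test)
    show "summable (\<lambda>m. w m + y m ^ 4 * w m)"
      using fourth' total by (intro summable_add) (auto simp: sums_iff)
    have "\<bar>u\<bar> ^ 3 \<le> 1 + u ^ 4" for u :: real
    proof (cases "\<bar>u\<bar> \<le> 1")
      case True
      hence "\<bar>u\<bar> ^ 3 \<le> 1" by (intro power_le_one) auto
      thus ?thesis using zero_le_power_eq[of u 4] by (simp add: add_increasing2)
    next
      case False
      hence "\<bar>u\<bar> ^ 3 \<le> \<bar>u\<bar> ^ 4" by (intro power_increasing) auto
      thus ?thesis by (simp add: power_even_abs)
    qed
    hence "norm (y m ^ 3 * w m) \<le> w m + y m ^ 4 * w m" for m
      using mult_right_mono[of "\<bar>y m\<bar> ^ 3" "1 + y m ^ 4" "w m"] nonneg[of m]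
      by (simp add: abs_mult power_abs algebra_simps)
    thus "\<exists>N. \<forall>n\<ge>N. norm (y n ^ 3 * w n) \<le> w n + y n ^ 4 * w n" by blast
  qed
  define m3 where "m3 = (\<Sum>m. y m ^ 3 * w m)"
  define m4 where "m4 = (\<Sum>m. y m ^ 4 * w m)"
  have m1: "(\<lambda>m. y m * w m) sums 0"
    using sums_diff[OF mean sums_mult[OF total, of \<mu>]] by (simp add: y_def algebra_simps)
  have m2: "(\<lambda>m. y m ^ 2 * w m) sums v" using var by (simp add: y_def)
  have m3: "(\<lambda>m. y m ^ 3 * w m) sums m3" using third by (simp add: m3_def summable_sums)
  have m4: "(\<lambda>m. y m ^ 4 * w m) sums m4" using fourth' by (simp add: m4_def summable_sums)
  have "norm (cis (- \<mu> * t) * cf t - of_real (exp (- v * t\<^sup>2 / 2)) + \<i> * of_real (m3 / 6 * t ^ 3))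
          \<le> (m4 / 24 + v\<^sup>2 / 4) * t ^ 4" for t
  proof -
    define T where "T u = 1 + \<i> * of_real u - of_real (u\<^sup>2 / 2) - \<i> * of_real (u ^ 3 / 6)" for u :: real
    have T: "norm (cis u - T u) \<le> u ^ 4 / 24" for u
    proof -
      have "norm (cis u - (\<Sum>k\<le>3. (\<i> * u) ^ k / fact k)) \<le> \<bar>u\<bar> ^ 4 / 24"
        using iexp_approx1[of u 3] by (simp add: cis_conv_exp fact_numeral)
      moreover have "(\<Sum>k\<le>3. (\<i> * u) ^ k / fact k) = T u"
        by (simp add: T_def numeral_eq_Suc field_simps)
      ultimately show ?thesis by (simp add: power_even_abs)
    qed
    have s1: "(\<lambda>m. of_real (w m) * cis (y m * t)) sums (cis (- \<mu> * t) * cf t)"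
    proof -
      have "cis (- \<mu> * t) * (of_real (w m) * cis (real m * t)) = of_real (w m) * cis (y m * t)" for m
        using cis_mult[of "- \<mu> * t" "real m * t"] by (simp add: y_def algebra_simps)
      thus ?thesis using sums_mult[OF cf_sums[of t], of "cis (- \<mu> * t)"] by (simp only:)
    qed
    have s2: "(\<lambda>m. of_real (w m) * T (y m * t)) sums
          (1 + \<i> * of_real (0 * t) - of_real (v * (t\<^sup>2 / 2)) - \<i> * of_real (m3 * (t ^ 3 / 6)))"
    proof -
      have "(\<lambda>m. of_real (w m) + \<i> * of_real (y m * w m * t) - of_real (y m ^ 2 * w m * (t\<^sup>2 / 2))
              - \<i> * of_real (y m ^ 3 * w m * (t ^ 3 / 6))) sums
          (of_real 1 + \<i> * of_real (0 * t) - of_real (v * (t\<^sup>2 / 2)) - \<i> * of_real (m3 * (t ^ 3 / 6)))"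
        by (intro sums_add sums_diff sums_mult sums_of_real sums_mult2 total m1 m2 m3)
      thus ?thesis
        by (simp add: T_def algebra_simps power_mult_distrib of_real_mult)
    qed
    have "norm ((cis (- \<mu> * t) * cf t) - (1 + \<i> * of_real (0 * t) - of_real (v * (t\<^sup>2 / 2)) - \<i> * of_real (m3 * (t ^ 3 / 6))))
           \<le> m4 * (t ^ 4 / 24)"
    proof -
      have "norm (of_real (w m) * cis (y m * t) - of_real (w m) * T (y m * t)) \<le> y m ^ 4 * w m * (t ^ 4 / 24)" for m
      proof -
        have "norm (of_real (w m) * cis (y m * t) - of_real (w m) * T (y m * t))
              = w m * norm (cis (y m * t) - T (y m * t))"
          using nonneg[of m] by (simp flip: right_diff_distrib add: norm_mult)
        also have "\<dots> \<le> w m * ((y m * t) ^ 4 / 24)"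
          using nonneg T by (intro mult_left_mono) auto
        finally show ?thesis by (simp add: power_mult_distrib mult_ac)
      qed
      hence "norm (\<Sum>m. of_real (w m) * cis (y m * t) - of_real (w m) * T (y m * t)) \<le> (\<Sum>m. y m ^ 4 * w m * (t ^ 4 / 24))"
        by (rule norm_suminf_le) (rule sums_summable[OF sums_mult2[OF m4]])
      thus ?thesis
        unfolding sums_unique[OF sums_diff[OF s1 s2], symmetric] sums_unique[OF sums_mult2[OF m4], symmetric] .
    qed
    moreover have "\<bar>exp (- (v * t\<^sup>2 / 2)) - (1 - v * t\<^sup>2 / 2)\<bar> \<le> (v * t\<^sup>2 / 2)\<^sup>2"
      by (rule abs_exp_minus_linear_le) (use variance_pos in auto)
    hence "norm (of_real (exp (- (v * t\<^sup>2 / 2)) - (1 - v * t\<^sup>2 / 2)) :: complex) \<le> v\<^sup>2 / 4 * t ^ 4"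
      unfolding norm_of_real
      by (simp add: power_mult_distrib power_divide flip: power_mult)
    ultimately have "norm (((cis (- \<mu> * t) * cf t) - (1 + \<i> * of_real (0 * t) - of_real (v * (t\<^sup>2 / 2)) - \<i> * of_real (m3 * (t ^ 3 / 6))))
          - of_real (exp (- (v * t\<^sup>2 / 2)) - (1 - v * t\<^sup>2 / 2))) \<le> m4 * (t ^ 4 / 24) + v\<^sup>2 / 4 * t ^ 4"
      by (meson add_mono norm_triangle_ineq4 order_trans)
    thus ?thesis by (simp add: algebra_simps)
  qed
  thus ?thesis by blast
qed

text \<open>With \<open>\<delta> = k \<mu> - n\<close>, the integrand of the inversion formula is \<open>cis (\<delta> t) a^k\<close>, where \<open>a\<close> is the
  centred characteristic function, and \<open>b = exp (- v t\<^sup>2 / 2)\<close> is real. Expanding \<open>a^k\<close> around \<open>b^k\<close>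
  to first order and \<open>cis (\<delta> t)\<close> around 1, the two corrections of lowest order, \<open>\<i> \<delta> t b^k\<close> and
  \<open>- \<i> k \<kappa> t\<^sup>3 b^(k-1)\<close>, are purely imaginary. All others are \<open>O(t\<^sup>2)\<close>, \<open>O(k t^4)\<close> or \<open>O(k\<^sup>2 t^6)\<close>
  times a Gaussian and \<open>(1 + \<bar>\<delta>\<bar>)\<^sup>2\<close>, and the powers of \<open>t\<close> with their factors integrate to \<open>O(k powr (-3/2))\<close>.\<close>

lemma integrand_bound:
  "\<exists>c>0. \<exists>C\<ge>1. c \<le> v / 2 \<and> (\<forall>k n t. \<bar>t\<bar> \<le> pi \<longrightarrow>
     \<bar>Re (cf t ^ k * cis (- real n * t)) - exp (- (real k * v / 2) * t\<^sup>2)\<bar>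
       \<le> C * (1 + \<bar>real k * \<mu> - real n\<bar>)\<^sup>2 * ((t\<^sup>2 + real k * t ^ 4 + (real k)\<^sup>2 * t ^ 6) * exp (- (c * real k) * t\<^sup>2)))"
proof -
  obtain c0 where c0: "c0 > 0" "\<And>t. \<bar>t\<bar> \<le> pi \<Longrightarrow> norm (cf t) \<le> exp (- c0 * t\<^sup>2)"
    using cf_decay by blast
  obtain \<kappa> C4 where C4: "\<And>t. \<bar>t\<bar> \<le> pi \<Longrightarrow>
      norm (cis (- \<mu> * t) * cf t - of_real (exp (- v * t\<^sup>2 / 2)) + \<i> * of_real (\<kappa> * t ^ 3)) \<le> C4 * t ^ 4"
    using centred_cf_expansion by blast
  define c where "c = min c0 (v / 2)"
  have c: "c > 0" "c \<le> c0" "c \<le> v / 2" using c0 variance_pos by (auto simp: c_def)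
  define M where "M = exp (2 * c * pi\<^sup>2)"
  define L where "L = \<bar>\<kappa>\<bar> + \<bar>C4\<bar> * pi"
  define S where "S = L\<^sup>2 + \<bar>C4\<bar> + \<bar>\<kappa>\<bar> + 1"
  have M: "M \<ge> 1" using c by (simp add: M_def)
  have S: "S \<ge> 1" by (simp add: S_def)
  have main: "\<bar>Re (cf t ^ k * cis (- real n * t)) - exp (- (real k * v / 2) * t\<^sup>2)\<bar>
       \<le> (M * S) * (1 + \<bar>real k * \<mu> - real n\<bar>)\<^sup>2 * ((t\<^sup>2 + real k * t ^ 4 + (real k)\<^sup>2 * t ^ 6) * exp (- (c * real k) * t\<^sup>2))"
    if t: "\<bar>t\<bar> \<le> pi" for k n t
  proof -
    define \<delta> where "\<delta> = real k * \<mu> - real n"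
    define a where "a = cis (- \<mu> * t) * cf t"
    define \<beta> where "\<beta> = exp (- v * t\<^sup>2 / 2)"
    define b where "b = complex_of_real \<beta>"
    define E where "E = exp (- c * t\<^sup>2)"
    define R where "R = a - b + \<i> * of_real (\<kappa> * t ^ 3)"
    define D where "D = a ^ k - b ^ k - of_nat k * b ^ (k - 1) * (a - b)"
    have E: "E > 0" "E \<le> 1" using c by (auto simp: E_def)
    have Ek: "E ^ k = exp (- (c * real k) * t\<^sup>2)"
      by (simp add: E_def mult_ac flip: exp_of_nat_mult)
    have t2: "t\<^sup>2 \<le> pi\<^sup>2" using t by (simp add: abs_le_square_iff[symmetric])
    \<comment> \<open>On the compact interval, a factor \<open>1 / E\<^sup>2\<close> costs no more than the constant \<open>M\<close>, so that
        powers of \<open>E\<close> with exponent \<open>k - 2\<close>, \<open>k - 1\<close> and \<open>k\<close> are all bounded by \<open>M \<cdot> E^k\<close>.\<close>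
    have "1 / E\<^sup>2 = exp (2 * c * t\<^sup>2)"
      by (simp add: E_def exp_minus field_simps flip: exp_double)
    also have "\<dots> \<le> M" unfolding M_def using t2 c by simp
    finally have ME: "1 / E\<^sup>2 \<le> M" .
    have ME1: "1 / E \<le> M"
    proof -
      have "E\<^sup>2 \<le> E" using E by (simp add: power2_eq_square mult_left_le)
      hence "1 / E \<le> 1 / E\<^sup>2" using E by (intro divide_left_mono) auto
      thus ?thesis using ME by linarith
    qed
    have na: "norm a \<le> E"
    proof -
      have "norm a \<le> exp (- c0 * t\<^sup>2)" using c0(2)[OF t] by (simp add: a_def norm_mult)
      also have "\<dots> \<le> E" unfolding E_def using c by (simp add: mult_right_mono)
      finally show ?thesis .
    qed
    have nb: "norm b \<le> E"
    proof -
      have "norm b = exp (- v * t\<^sup>2 / 2)" by (simp add: b_def \<beta>_def)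
      also have "\<dots> \<le> E" unfolding E_def using mult_right_mono[OF c(3), of "t\<^sup>2"] by simp
      finally show ?thesis .
    qed
    have nR: "norm R \<le> \<bar>C4\<bar> * t ^ 4"
    proof -
      have "norm R \<le> C4 * t ^ 4" using C4[OF t] by (simp add: R_def a_def b_def \<beta>_def)
      also have "\<dots> \<le> \<bar>C4\<bar> * t ^ 4" by (intro mult_right_mono) auto
      finally show ?thesis .
    qed
    have nab: "(norm (a - b))\<^sup>2 \<le> L\<^sup>2 * t ^ 6"
    proof -
      have "norm (a - b) = norm (R - \<i> * of_real (\<kappa> * t ^ 3))" by (simp add: R_def)
      also have "\<dots> \<le> \<bar>C4\<bar> * t ^ 4 + \<bar>\<kappa>\<bar> * \<bar>t\<bar> ^ 3"
        by (rule order_trans[OF norm_triangle_ineq4])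
           (use nR in \<open>auto simp: norm_mult norm_power\<close>)
      also have "t ^ 4 = \<bar>t\<bar> * \<bar>t\<bar> ^ 3" by (simp add: power_even_abs flip: power_Suc)
      also have "\<bar>C4\<bar> * (\<bar>t\<bar> * \<bar>t\<bar> ^ 3) \<le> \<bar>C4\<bar> * (pi * \<bar>t\<bar> ^ 3)"
        using t by (intro mult_left_mono mult_right_mono) auto
      finally have "norm (a - b) \<le> L * \<bar>t\<bar> ^ 3" by (simp add: L_def algebra_simps)
      hence "(norm (a - b))\<^sup>2 \<le> (L * \<bar>t\<bar> ^ 3)\<^sup>2" by (intro power_mono) auto
      thus ?thesis by (simp add: power_mult_distrib power_even_abs flip: power_mult)
    qed
    have nbk1: "real k * norm b ^ (k - 1) \<le> real k * (M * E ^ k)"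
    proof (cases k)
      case (Suc j)
      have "norm b ^ j \<le> E ^ j" using nb by (intro power_mono) auto
      also have "\<dots> = 1 / E * E ^ k" using Suc E by simp
      also have "\<dots> \<le> M * E ^ k" using ME1 E by (intro mult_right_mono) auto
      finally show ?thesis using Suc by (intro mult_left_mono) auto
    qed simp
    have nbk: "norm b ^ k \<le> M * E ^ k"
    proof -
      have "norm b ^ k \<le> E ^ k" using nb by (intro power_mono) auto
      also have "\<dots> \<le> M * E ^ k" using M E by simp
      finally show ?thesis .
    qed
    have nD: "norm D \<le> (real k)\<^sup>2 * (M * E ^ k) * (L\<^sup>2 * t ^ 6)"
    proof -
      have "norm D \<le> (real k)\<^sup>2 * (E ^ k / E\<^sup>2) * (norm (a - b))\<^sup>2"
        unfolding D_def by (rule power_diff_linear_bound[OF na nb E(1)])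
      also have "\<dots> \<le> (real k)\<^sup>2 * (M * E ^ k) * (L\<^sup>2 * t ^ 6)"
      proof (intro mult_mono nab)
        show "E ^ k / E\<^sup>2 \<le> M * E ^ k" using mult_right_mono[OF ME, of "E ^ k"] E by simp
      qed (use E M in auto)
      finally show ?thesis .
    qed
    have cis0: "norm (cis u - 1) \<le> \<bar>u\<bar>" for u
      using iexp_approx1[of u 0] by (simp add: cis_conv_exp)
    have cis1: "norm (cis u - 1 - \<i> * u) \<le> u\<^sup>2" for u
    proof -
      have "norm (cis u - 1 - \<i> * u) \<le> u\<^sup>2 / 2"
        using iexp_approx1[of u 1] by (simp add: cis_conv_exp eval_nat_numeral diff_diff_eq)
      thus ?thesis using zero_le_power2[of u] by linarith
    qed
    \<comment> \<open>The remainder that is left when the two purely imaginary terms are split off.\<close>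
    define X where "X = cis (\<delta> * t) * D + cis (\<delta> * t) * (of_nat k * b ^ (k - 1) * R)
        - (cis (\<delta> * t) - 1) * (\<i> * of_nat k * of_real (\<kappa> * t ^ 3) * b ^ (k - 1))
        + (cis (\<delta> * t) - 1 - \<i> * of_real (\<delta> * t)) * b ^ k"
    have "cf t ^ k * cis (- real n * t) = cis (\<delta> * t) * a ^ k"
    proof -
      have "a ^ k = cis (real k * (- \<mu> * t)) * cf t ^ k"
        by (simp add: a_def power_mult_distrib Complex.DeMoivre)
      hence "cis (\<delta> * t) * a ^ k = cis (\<delta> * t + real k * (- \<mu> * t)) * cf t ^ k"
        by (simp add: cis_mult mult.assoc[symmetric] del: mult_minus_left)
      also have "\<delta> * t + real k * (- \<mu> * t) = - real n * t" by (simp add: \<delta>_def algebra_simps)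
      finally show ?thesis by (simp add: mult.commute)
    qed
    also have "cis (\<delta> * t) * a ^ k = b ^ k + X + \<i> * of_real (\<delta> * t) * b ^ k
                 - \<i> * of_nat k * of_real (\<kappa> * t ^ 3) * b ^ (k - 1)"
    proof -
      have ring: "c * (D + p + K * (R - q)) = p + (c * D + c * (K * R) - (c - 1) * (K * q) + (c - 1 - d) * p) + d * p - K * q"
        for c D p K R q d :: complex by (simp add: algebra_simps)
      have "a ^ k = D + b ^ k + of_nat k * b ^ (k - 1) * (R - \<i> * of_real (\<kappa> * t ^ 3))"
        by (simp add: D_def R_def)
      thus ?thesis unfolding X_def
        using ring[of "cis (\<delta> * t)" D "b ^ k" "of_nat k * b ^ (k - 1)" R "\<i> * of_real (\<kappa> * t ^ 3)" "\<i> * of_real (\<delta> * t)"]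
        by (simp add: mult_ac)
    qed
    finally have "Re (cf t ^ k * cis (- real n * t)) - \<beta> ^ k = Re X"
      by (simp add: b_def flip: of_real_power)
    moreover have "\<beta> ^ k = exp (- (real k * v / 2) * t\<^sup>2)"
      by (simp add: \<beta>_def mult_ac flip: exp_of_nat_mult)
    moreover have "\<bar>Re X\<bar> \<le> norm X" by (rule abs_Re_le_cmod)
    moreover have "norm X \<le> (M * S) * (1 + \<bar>\<delta>\<bar>)\<^sup>2 * ((t\<^sup>2 + real k * t ^ 4 + (real k)\<^sup>2 * t ^ 6) * E ^ k)"
    proof -
      have "norm X \<le> norm D + real k * norm b ^ (k - 1) * norm R
              + \<bar>\<delta> * t\<bar> * (\<bar>\<kappa>\<bar> * \<bar>t\<bar> ^ 3 * (real k * norm b ^ (k - 1))) + (\<delta> * t)\<^sup>2 * norm b ^ k"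
      proof -
        have tri: "norm (A + B - C + F) \<le> norm A + norm B + norm C + norm F" for A B C F :: complex
          using norm_triangle_ineq[of "A + B - C" F] norm_triangle_ineq4[of "A + B" C] norm_triangle_ineq[of A B]
          by linarith
        have "norm ((cis (\<delta> * t) - 1) * (\<i> * of_nat k * of_real (\<kappa> * t ^ 3) * b ^ (k - 1)))
                = norm (cis (\<delta> * t) - 1) * (\<bar>\<kappa>\<bar> * \<bar>t\<bar> ^ 3 * (real k * norm b ^ (k - 1)))"
          by (simp add: norm_mult norm_power abs_mult power_abs mult_ac)
        also have "\<dots> \<le> \<bar>\<delta> * t\<bar> * (\<bar>\<kappa>\<bar> * \<bar>t\<bar> ^ 3 * (real k * norm b ^ (k - 1)))"
          by (intro mult_right_mono cis0) auto
        finally have "norm ((cis (\<delta> * t) - 1) * (\<i> * of_nat k * of_real (\<kappa> * t ^ 3) * b ^ (k - 1))) \<le> \<dots>" .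
        moreover have "norm ((cis (\<delta> * t) - 1 - \<i> * of_real (\<delta> * t)) * b ^ k) \<le> (\<delta> * t)\<^sup>2 * norm b ^ k"
          unfolding norm_mult norm_power by (intro mult_right_mono cis1) auto
        moreover have "norm (cis (\<delta> * t) * D) = norm D" by (simp add: norm_mult)
        moreover have "norm (cis (\<delta> * t) * (of_nat k * b ^ (k - 1) * R)) = real k * norm b ^ (k - 1) * norm R"
          by (simp add: norm_mult norm_power)
        ultimately show ?thesis unfolding X_def using tri by (smt (verit))
      qed
      also have "\<dots> \<le> (real k)\<^sup>2 * (M * E ^ k) * (L\<^sup>2 * t ^ 6) + real k * (M * E ^ k) * (\<bar>C4\<bar> * t ^ 4)
              + \<bar>\<delta> * t\<bar> * (\<bar>\<kappa>\<bar> * \<bar>t\<bar> ^ 3 * (real k * (M * E ^ k))) + (\<delta> * t)\<^sup>2 * (M * E ^ k)"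
        by (intro add_mono nD mult_mono[OF nbk1 nR] mult_left_mono[OF nbk] mult_left_mono[OF mult_left_mono[OF nbk1]])
           (use M E in auto)
      also have "\<dots> = M * E ^ k * (L\<^sup>2 * ((real k)\<^sup>2 * t ^ 6) + \<bar>C4\<bar> * (real k * t ^ 4)
              + \<bar>\<kappa>\<bar> * \<bar>\<delta>\<bar> * (real k * t ^ 4) + \<delta>\<^sup>2 * t\<^sup>2)"
      proof -
        have "\<bar>t\<bar> * \<bar>t\<bar> ^ 3 = t ^ 4" by (simp add: power_even_abs flip: power_Suc)
        hence "\<bar>\<delta> * t\<bar> * (\<bar>\<kappa>\<bar> * \<bar>t\<bar> ^ 3 * (real k * (M * E ^ k))) = M * E ^ k * (\<bar>\<kappa>\<bar> * \<bar>\<delta>\<bar> * (real k * t ^ 4))"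
          by (simp add: abs_mult mult_ac)
        thus ?thesis by (simp add: algebra_simps)
      qed
      also have "\<dots> \<le> M * E ^ k * (S * (1 + \<bar>\<delta>\<bar>)\<^sup>2 * (t\<^sup>2 + real k * t ^ 4 + (real k)\<^sup>2 * t ^ 6))"
      proof (intro mult_left_mono)
        define W where "W = (1 + \<bar>\<delta>\<bar>)\<^sup>2"
        have W: "1 \<le> W" "\<bar>\<delta>\<bar> \<le> W" "\<delta>\<^sup>2 \<le> W"
          by (auto simp: W_def power2_eq_square algebra_simps)
        have S': "L\<^sup>2 \<le> S * W" "\<bar>C4\<bar> + \<bar>\<kappa>\<bar> * \<bar>\<delta>\<bar> \<le> S * W" "\<delta>\<^sup>2 \<le> S * W"
        proof -
          have "L\<^sup>2 * 1 \<le> S * W" using W by (intro mult_mono) (auto simp: S_def)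
          thus "L\<^sup>2 \<le> S * W" by simp
          have "\<bar>C4\<bar> * 1 + \<bar>\<kappa>\<bar> * \<bar>\<delta>\<bar> \<le> \<bar>C4\<bar> * W + \<bar>\<kappa>\<bar> * W"
            using W by (intro add_mono mult_left_mono) auto
          also have "\<dots> = (\<bar>C4\<bar> + \<bar>\<kappa>\<bar>) * W" by (simp add: algebra_simps)
          also have "\<dots> \<le> S * W" using W by (intro mult_right_mono) (auto simp: S_def)
          finally show "\<bar>C4\<bar> + \<bar>\<kappa>\<bar> * \<bar>\<delta>\<bar> \<le> S * W" by simp
          have "1 * \<delta>\<^sup>2 \<le> S * W" using W S by (intro mult_mono) auto
          thus "\<delta>\<^sup>2 \<le> S * W" by simp
        qed
        have "L\<^sup>2 * ((real k)\<^sup>2 * t ^ 6) + (\<bar>C4\<bar> + \<bar>\<kappa>\<bar> * \<bar>\<delta>\<bar>) * (real k * t ^ 4) + \<delta>\<^sup>2 * t\<^sup>2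
            \<le> S * W * ((real k)\<^sup>2 * t ^ 6) + S * W * (real k * t ^ 4) + S * W * t\<^sup>2"
          by (intro add_mono mult_right_mono S') auto
        thus "L\<^sup>2 * ((real k)\<^sup>2 * t ^ 6) + \<bar>C4\<bar> * (real k * t ^ 4)
              + \<bar>\<kappa>\<bar> * \<bar>\<delta>\<bar> * (real k * t ^ 4) + \<delta>\<^sup>2 * t\<^sup>2 \<le> S * (1 + \<bar>\<delta>\<bar>)\<^sup>2 * (t\<^sup>2 + real k * t ^ 4 + (real k)\<^sup>2 * t ^ 6)"
          by (simp add: W_def[symmetric] algebra_simps)
      qed (use M E in auto)
      finally show ?thesis by (simp add: mult_ac)
    qed
    ultimately show ?thesis unfolding Ek \<delta>_def by linarith
  qed
  have "M * S \<ge> 1" using M S mult_mono[of 1 M 1 S] by simp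
  with main c show ?thesis by blast
qed

text \<open>Integrate \<open>integrand_bound\<close> and compare with the Gaussian integral over the whole line.\<close>

theorem local_limit:
  "\<exists>C. \<forall>k n. k \<ge> 1 \<longrightarrow>
     \<bar>conv_pow w k n - 1 / sqrt (2 * pi * real k * v)\<bar> \<le> C * (1 + \<bar>real k * \<mu> - real n\<bar>)\<^sup>2 / (real k * sqrt (real k))"
proof -
  obtain c C where c: "c > 0" "c \<le> v / 2" and C: "C \<ge> 1" and
    bound: "\<And>k n t. \<bar>t\<bar> \<le> pi \<Longrightarrow>
     \<bar>Re (cf t ^ k * cis (- real n * t)) - exp (- (real k * v / 2) * t\<^sup>2)\<bar>
       \<le> C * (1 + \<bar>real k * \<mu> - real n\<bar>)\<^sup>2 * ((t\<^sup>2 + real k * t ^ 4 + (real k)\<^sup>2 * t ^ 6) * exp (- (c * real k) * t\<^sup>2))"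
    using integrand_bound by blast
  define B where "B = sqrt (pi / c) * (1 / (2 * c) + 3 / (4 * c\<^sup>2) + 15 / (8 * c ^ 3))"
  have "\<bar>conv_pow w k n - 1 / sqrt (2 * pi * real k * v)\<bar> \<le> (C * B / (2 * pi)) * (1 + \<bar>real k * \<mu> - real n\<bar>)\<^sup>2 / (real k * sqrt (real k))"
    if k: "k \<ge> 1" for k n
  proof -
    define W where "W = C * (1 + \<bar>real k * \<mu> - real n\<bar>)\<^sup>2"
    have "1 * 1 \<le> C * (1 + \<bar>real k * \<mu> - real n\<bar>)\<^sup>2" using C by (intro mult_mono) auto
    hence W: "W \<ge> 1" by (simp add: W_def)
    \<comment> \<open>Extend the integrand by 0. The bound \<open>H\<close> also covers the Gaussian tail outside \<open>[-\<pi>, \<pi>]\<close>, since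
        there \<open>t\<^sup>2 \<ge> 1\<close>.\<close>
    define F where "F t = (if t \<in> {-pi..pi} then Re (cf t ^ k * cis (- real n * t)) else 0)" for t
    define G where "G t = exp (- (real k * v / 2) * t\<^sup>2)" for t
    define H where "H t = W * ((t\<^sup>2 + real k * t ^ 4 + (real k)\<^sup>2 * t ^ 6) * exp (- (c * real k) * t\<^sup>2))" for t
    have F: "(F has_integral 2 * pi * conv_pow w k n) UNIV"
      unfolding F_def[abs_def] by (subst has_integral_restrict_UNIV) (rule cf_fourier_inversion)
    have G: "(G has_integral sqrt (pi / (real k * v / 2))) UNIV"
      using has_integral_even_gaussian[of "real k * v / 2" 0] k variance_pos by (simp add: G_def[abs_def])
    have H: "(H has_integral W * (B / (real k * sqrt (real k)))) UNIV"
    proof -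
      define g where "g m t = t ^ (2 * m) * exp (- (c * real k) * t\<^sup>2)" for m t
      have g: "(g m has_integral sqrt (pi / (c * real k)) * (fact (2 * m) / ((4 * (c * real k)) ^ m * fact m))) UNIV" for m
        unfolding g_def using c k by (intro has_integral_even_gaussian) auto
      have "((\<lambda>t. W * (g 1 t + real k * g 2 t + (real k)\<^sup>2 * g 3 t)) has_integral
          W * (sqrt (pi / (c * real k)) * (fact (2 * 1) / ((4 * (c * real k)) ^ 1 * fact 1))
            + real k * (sqrt (pi / (c * real k)) * (fact (2 * 2) / ((4 * (c * real k)) ^ 2 * fact 2)))
            + (real k)\<^sup>2 * (sqrt (pi / (c * real k)) * (fact (2 * 3) / ((4 * (c * real k)) ^ 3 * fact 3))))) UNIV"
        by (intro has_integral_mult_right has_integral_add g)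
      moreover have "W * (g 1 t + real k * g 2 t + (real k)\<^sup>2 * g 3 t) = H t" for t
        by (simp add: g_def H_def algebra_simps power2_eq_square)
      moreover have "sqrt (pi / (c * real k)) * (fact (2 * 1) / ((4 * (c * real k)) ^ 1 * fact 1))
            + real k * (sqrt (pi / (c * real k)) * (fact (2 * 2) / ((4 * (c * real k)) ^ 2 * fact 2)))
            + (real k)\<^sup>2 * (sqrt (pi / (c * real k)) * (fact (2 * 3) / ((4 * (c * real k)) ^ 3 * fact 3)))
            = B / (real k * sqrt (real k))"
      proof -
        have "sqrt (pi / (c * real k)) = sqrt (pi / c) / sqrt (real k)"
          by (simp add: real_sqrt_divide real_sqrt_mult)
        moreover have "u * (1 / (2 * c)) / real k = u * (2 / (4 * (c * real k)))"
          "u * (3 / (4 * c\<^sup>2)) / real k = real k * (u * (24 / ((4 * (c * real k)) ^ 2 * 2)))"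
          "u * (15 / (8 * c ^ 3)) / real k = (real k)\<^sup>2 * (u * (720 / ((4 * (c * real k)) ^ 3 * 6)))" for u
          using k c by (simp_all add: field_simps power2_eq_square power3_eq_cube)
        moreover have "B / (real k * sqrt (real k)) = u * (1 / (2 * c)) / real k + u * (3 / (4 * c\<^sup>2)) / real k + u * (15 / (8 * c ^ 3)) / real k"
          if "u = sqrt (pi / c) / sqrt (real k)" for u
          unfolding that B_def by (simp add: ring_distribs add_divide_distrib mult_ac)
        ultimately show ?thesis
          by (simp only: fact_numeral) (simp add: fact_numeral)
      qed
      ultimately show ?thesis by simp
    qed
    have le: "norm (F t - G t) \<le> H t" for t
    proof (cases "\<bar>t\<bar> \<le> pi")
      case True
      hence "F t = Re (cf t ^ k * cis (- real n * t))" by (auto simp: F_def abs_le_iff)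
      with bound[OF True, of k n] show ?thesis by (simp add: G_def H_def W_def)
    next
      case False
      have "1 \<le> \<bar>t\<bar>" using False pi_ge_two by linarith
      hence t1: "1 \<le> t\<^sup>2" by (metis one_le_power power2_abs)
      have "c * (real k * t\<^sup>2) \<le> v / 2 * (real k * t\<^sup>2)" using c by (intro mult_right_mono) auto
      hence "- (real k * v / 2) * t\<^sup>2 \<le> - (c * real k) * t\<^sup>2" by argo
      hence "G t \<le> exp (- (c * real k) * t\<^sup>2)" unfolding G_def by (rule exp_le_cancel_iff[THEN iffD2])
      also have "\<dots> \<le> W * ((t\<^sup>2 + real k * t ^ 4 + (real k)\<^sup>2 * t ^ 6) * exp (- (c * real k) * t\<^sup>2))"
      proof -
        have "1 \<le> t\<^sup>2 + real k * t ^ 4 + (real k)\<^sup>2 * t ^ 6" using t1 by (simp add: add_increasing2)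
        hence "1 * 1 \<le> W * (t\<^sup>2 + real k * t ^ 4 + (real k)\<^sup>2 * t ^ 6)" using W by (intro mult_mono) auto
        hence "1 * exp (- (c * real k) * t\<^sup>2) \<le> W * (t\<^sup>2 + real k * t ^ 4 + (real k)\<^sup>2 * t ^ 6) * exp (- (c * real k) * t\<^sup>2)"
          by (intro mult_right_mono) auto
        thus ?thesis by (simp add: mult_ac)
      qed
      finally have "G t \<le> H t" by (simp add: H_def)
      moreover have "F t = 0" using False by (auto simp: F_def)
      moreover have "G t \<ge> 0" by (simp add: G_def)
      ultimately show ?thesis by simp
    qed
    have diff: "((\<lambda>t. F t - G t) has_integral (2 * pi * conv_pow w k n - sqrt (pi / (real k * v / 2)))) UNIV"
      by (intro has_integral_diff F G)
    have "norm (integral UNIV (\<lambda>t. F t - G t)) \<le> integral UNIV H"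
      using diff H le by (intro integral_norm_bound_integral) (auto simp: has_integral_integrable)
    hence "\<bar>2 * pi * conv_pow w k n - sqrt (pi / (real k * v / 2))\<bar> \<le> W * (B / (real k * sqrt (real k)))"
      using diff H by (simp add: integral_unique)
    hence "\<bar>2 * pi * conv_pow w k n - sqrt (pi / (real k * v / 2))\<bar> / (2 * pi) \<le> W * (B / (real k * sqrt (real k))) / (2 * pi)"
      by (intro divide_right_mono) auto
    moreover have "\<bar>2 * pi * conv_pow w k n - sqrt (pi / (real k * v / 2))\<bar> / (2 * pi)
        = \<bar>conv_pow w k n - 1 / sqrt (2 * pi * real k * v)\<bar>"
    proof -
      have "sqrt (pi / (real k * v / 2)) = sqrt ((2 * pi)\<^sup>2 / (2 * pi * real k * v))"
        by (rule arg_cong[of _ _ sqrt]) (simp add: power2_eq_square mult_ac)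
      also have "\<dots> = 2 * pi / sqrt (2 * pi * real k * v)"
        by (simp only: real_sqrt_divide real_sqrt_abs) simp
      finally have "2 * pi * conv_pow w k n - sqrt (pi / (real k * v / 2))
        = 2 * pi * (conv_pow w k n - 1 / sqrt (2 * pi * real k * v))" by (simp add: algebra_simps)
      thus ?thesis by (simp add: abs_mult)
    qed
    ultimately show ?thesis by (simp add: W_def mult_ac)
  qed
  thus ?thesis by blast
qed

end

section \<open>The law of the number of types\<close>

text \<open>The law of Sibuya with parameter \<open>\<alpha>\<close>: \<open>\<alpha>\<close> times the weight of a type of multiplicity \<open>j\<close> in the
  Ewens-Pitman formula.\<close>

definition sibuya :: "real \<Rightarrow> nat \<Rightarrow> real" where
  "sibuya \<alpha> j = (if j = 0 then 0 else \<alpha> * pochhammer (1 - \<alpha>) (j - 1) / fact j)"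

text \<open>The part of \<open>P(K\<^sub>n = k)\<close> that does not depend on the multiplicities. The division by \<open>\<alpha>^k\<close> makes up
  for the factor \<open>\<alpha>\<close> in the Sibuya weights, the one by \<open>k!\<close> for the order of the parts.\<close>

definition types_weight :: "real \<Rightarrow> real \<Rightarrow> nat \<Rightarrow> nat \<Rightarrow> real" where
  "types_weight \<alpha> \<theta> n k = fact n * ep_ratio \<alpha> \<theta> n k / (fact k * \<alpha> ^ k)"

text \<open>Partitions of \<open>n\<close> into \<open>k\<close> parts of size at most \<open>N\<close>. Functions have to vanish outside \<open>{1..N}\<close> so that
  distinct members describe distinct partitions.\<close>

definition partition_mults :: "nat \<Rightarrow> nat \<Rightarrow> nat \<Rightarrow> (nat \<Rightarrow> nat) set" where
  "partition_mults N n k =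
     {m. (\<forall>j. j \<notin> {1..N} \<longrightarrow> m j = 0) \<and> (\<Sum>j=1..N. m j) = k \<and> (\<Sum>j=1..N. j * m j) = n}"

lemma finite_partition_mults: "finite (partition_mults N n k)"
proof (rule finite_subset)
  show "partition_mults N n k \<subseteq> {m. \<forall>j. (j \<in> {1..N} \<longrightarrow> m j \<in> {..k}) \<and> (j \<notin> {1..N} \<longrightarrow> m j = 0)}"
    using member_le_sum[of _ "{1..N}"] by (auto simp: partition_mults_def)
  show "finite {m. \<forall>j. (j \<in> {1..N} \<longrightarrow> m j \<in> {..k}) \<and> (j \<notin> {1..N} \<longrightarrow> m j = (0::nat))}"
    by (rule finite_set_of_finite_funs) auto
qed

lemma conv_pow_cong:
  assumes "\<And>j. j \<le> n \<Longrightarrow> a j = b j"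
  shows "conv_pow a k n = conv_pow b k n"
  using assms
proof (induction k arbitrary: n)
  case (Suc k)
  show ?case unfolding conv_pow_Suc
    by (intro sum.cong refl arg_cong2[where f = "(*)"] Suc) (auto intro: Suc.prems)
qed (simp add: conv_pow_0)

text \<open>Classify partitions by the number \<open>i\<close> of parts of the largest size \<open>N + 1\<close>, and remove those parts.\<close>

lemma sum_partition_mults_Suc:
  fixes p :: "nat \<Rightarrow> real"
  shows "(\<Sum>m\<in>partition_mults (Suc N) n k. \<Prod>j=1..Suc N. p j ^ m j / fact (m j)) =
    (\<Sum>i\<le>k. if Suc N * i \<le> n then p (Suc N) ^ i / fact i *
        (\<Sum>m\<in>partition_mults N (n - Suc N * i) (k - i). \<Prod>j=1..N. p j ^ m j / fact (m j)) else 0)"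
proof -
  define I where "I = {i. i \<le> k \<and> Suc N * i \<le> n}"
  have fin: "finite I" by (simp add: I_def)
  have "(\<Sum>m\<in>partition_mults (Suc N) n k. \<Prod>j=1..Suc N. p j ^ m j / fact (m j)) =
    (\<Sum>(i, m)\<in>Sigma I (\<lambda>i. partition_mults N (n - Suc N * i) (k - i)).
        p (Suc N) ^ i / fact i * (\<Prod>j=1..N. p j ^ m j / fact (m j)))"
  proof (rule sum.reindex_bij_witness[of _ "\<lambda>(i, m). m(Suc N := i)" "\<lambda>m. (m (Suc N), m(Suc N := 0))"])
    fix m assume "m \<in> partition_mults (Suc N) n k"
    hence m: "\<And>j. j \<notin> {1..Suc N} \<Longrightarrow> m j = 0" "(\<Sum>j=1..Suc N. m j) = k" "(\<Sum>j=1..Suc N. j * m j) = n"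
      by (auto simp: partition_mults_def)
    have "(\<Sum>j=1..N. (m(Suc N := 0)) j) = (\<Sum>j=1..N. m j)"
         "(\<Sum>j=1..N. j * (m(Suc N := 0)) j) = (\<Sum>j=1..N. j * m j)"
      by (auto intro!: sum.cong)
    thus "(m (Suc N), m(Suc N := 0)) \<in> Sigma I (\<lambda>i. partition_mults N (n - Suc N * i) (k - i))"
      using m by (auto simp: I_def partition_mults_def)
    show "(case (m (Suc N), m(Suc N := 0)) of (i, m) \<Rightarrow> m(Suc N := i)) = m" by auto
    have "(\<Prod>j=1..N. p j ^ (m(Suc N := 0)) j / fact ((m(Suc N := 0)) j)) = (\<Prod>j=1..N. p j ^ m j / fact (m j))"
      by (intro prod.cong) auto
    thus "(case (m (Suc N), m(Suc N := 0)) of (i, m) \<Rightarrow> p (Suc N) ^ i / fact i * (\<Prod>j=1..N. p j ^ m j / fact (m j)))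
       = (\<Prod>j=1..Suc N. p j ^ m j / fact (m j))"
      by (simp del: fun_upd_apply)
  next
    fix q assume q: "q \<in> Sigma I (\<lambda>i. partition_mults N (n - Suc N * i) (k - i))"
    obtain i m where im: "q = (i, m)" by (cases q)
    have i: "i \<le> k" "Suc N * i \<le> n" and m: "\<And>j. j \<notin> {1..N} \<Longrightarrow> m j = 0"
      "(\<Sum>j=1..N. m j) = k - i" "(\<Sum>j=1..N. j * m j) = n - Suc N * i"
      using q im by (auto simp: I_def partition_mults_def)
    have "(\<Sum>j=1..N. (m(Suc N := i)) j) = (\<Sum>j=1..N. m j)"
         "(\<Sum>j=1..N. j * (m(Suc N := i)) j) = (\<Sum>j=1..N. j * m j)"
      by (auto intro!: sum.cong)
    hence "(\<Sum>j=1..Suc N. (m(Suc N := i)) j) = k" "(\<Sum>j=1..Suc N. j * (m(Suc N := i)) j) = n"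
      using m i by (simp_all del: fun_upd_apply add: fun_upd_same)
    thus "(case q of (i, m) \<Rightarrow> m(Suc N := i)) \<in> partition_mults (Suc N) n k"
      using m by (auto simp: im partition_mults_def)
    have "m(Suc N := 0) = m" using m(1)[of "Suc N"] by auto
    thus "((case q of (i, m) \<Rightarrow> m(Suc N := i)) (Suc N), (case q of (i, m) \<Rightarrow> m(Suc N := i))(Suc N := 0)) = q"
      by (simp add: im)
  qed
  also have "\<dots> = (\<Sum>i\<in>I. p (Suc N) ^ i / fact i *
        (\<Sum>m\<in>partition_mults N (n - Suc N * i) (k - i). \<Prod>j=1..N. p j ^ m j / fact (m j)))"
    using fin by (subst sum.Sigma[symmetric]) (auto simp: finite_partition_mults sum_distrib_left)
  also have "\<dots> = (\<Sum>i\<le>k. if Suc N * i \<le> n then p (Suc N) ^ i / fact i *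
        (\<Sum>m\<in>partition_mults N (n - Suc N * i) (k - i). \<Prod>j=1..N. p j ^ m j / fact (m j)) else 0)"
    by (intro sum.mono_neutral_cong_left) (auto simp: I_def)
  finally show ?thesis .
qed

text \<open>The multinomial theorem for power series, proved by induction on the largest part: adding the
  monomial \<open>p (N + 1) X^(N + 1)\<close> to the series and expanding the power binomially leads to the recursion of
  \<open>sum_partition_mults_Suc\<close>.\<close>

lemma conv_pow_truncated:
  fixes p :: "nat \<Rightarrow> real"
  shows "conv_pow (\<lambda>j. if j \<in> {1..N} then p j else 0) k n =
    fact k * (\<Sum>m\<in>partition_mults N n k. \<Prod>j=1..N. p j ^ m j / fact (m j))"
proof (induction N arbitrary: n k)
  case 0
  have "conv_pow (\<lambda>j. 0) k n = (if k = 0 \<and> n = 0 then 1 else 0)" for n k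
    by (cases k) (auto simp: conv_pow_0 conv_pow_Suc)
  moreover have "partition_mults 0 n k = (if k = 0 \<and> n = 0 then {\<lambda>_. 0} else {})"
    by (auto simp: partition_mults_def)
  ultimately show ?case by simp
next
  case (Suc N)
  define a where "a = Abs_fps (\<lambda>j. if j \<in> {1..N} then p j else 0)"
  define b where "b = fps_const (p (Suc N)) * fps_X ^ Suc N"
  have ab: "Abs_fps (\<lambda>j. if j \<in> {1..Suc N} then p j else 0) = b + a"
    by (rule fps_ext) (auto simp: a_def b_def fps_X_power_iff)
  have coeff: "fps_nth (b ^ i * a ^ l) n =
      (if Suc N * i \<le> n then p (Suc N) ^ i * fps_nth (a ^ l) (n - Suc N * i) else 0)" for i l
  proof -
    have "b ^ i * a ^ l = fps_const (p (Suc N) ^ i) * (fps_X ^ (Suc N * i) * a ^ l)"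
      by (simp only: b_def power_mult_distrib power_mult fps_const_power mult.assoc)
    thus ?thesis by (simp only: fps_mult_left_const_nth fps_X_power_mult_nth) auto
  qed
  have "conv_pow (\<lambda>j. if j \<in> {1..Suc N} then p j else 0) k n = fps_nth ((b + a) ^ k) n"
    unfolding conv_pow_def ab ..
  also have "\<dots> = (\<Sum>i\<le>k. real (k choose i) * fps_nth (b ^ i * a ^ (k - i)) n)"
    unfolding binomial_ring fps_sum_nth
    by (intro sum.cong refl) (simp only: fps_of_nat[symmetric] mult.assoc fps_mult_left_const_nth)
  also have "\<dots> = (\<Sum>i\<le>k. fact k * (if Suc N * i \<le> n then p (Suc N) ^ i / fact i *
        (\<Sum>m\<in>partition_mults N (n - Suc N * i) (k - i). \<Prod>j=1..N. p j ^ m j / fact (m j)) else 0))"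
  proof (intro sum.cong refl)
    fix i assume "i \<in> {..k}"
    hence i: "i \<le> k" by simp
    show "real (k choose i) * fps_nth (b ^ i * a ^ (k - i)) n = fact k * (if Suc N * i \<le> n then p (Suc N) ^ i / fact i *
        (\<Sum>m\<in>partition_mults N (n - Suc N * i) (k - i). \<Prod>j=1..N. p j ^ m j / fact (m j)) else 0)"
      unfolding coeff using Suc.IH[of "k - i" "n - Suc N * i"] binomial_fact[OF i, where ?'a = real]
      by (simp del: mult_Suc add: conv_pow_def a_def)
  qed
  also have "\<dots> = fact k * (\<Sum>m\<in>partition_mults (Suc N) n k. \<Prod>j=1..Suc N. p j ^ m j / fact (m j))"
    unfolding sum_partition_mults_Suc by (simp only: sum_distrib_left)
  finally show ?case .
qed

text \<open>Coefficients of index above \<open>n\<close> do not affect the \<open>n\<close>-th coefficient of a power, so the truncated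
  version applies with \<open>N = n\<close>.\<close>

lemma sum_ep_prob:
  assumes "0 < \<alpha>"
  shows "(\<Sum>m\<in>partition_mults n n k. ep_prob \<alpha> \<theta> n m k) = types_weight \<alpha> \<theta> n k * conv_pow (sibuya \<alpha>) k n"
proof -
  have "conv_pow (sibuya \<alpha>) k n = conv_pow (\<lambda>j. if j \<in> {1..n} then sibuya \<alpha> j else 0) k n"
    by (rule conv_pow_cong) (auto simp: sibuya_def)
  also note conv_pow_truncated
  finally have c: "conv_pow (sibuya \<alpha>) k n = fact k * (\<Sum>m\<in>partition_mults n n k. \<Prod>j=1..n. sibuya \<alpha> j ^ m j / fact (m j))" .
  have "ep_prob \<alpha> \<theta> n m k = fact n * ep_ratio \<alpha> \<theta> n k / \<alpha> ^ k * (\<Prod>j=1..n. sibuya \<alpha> j ^ m j / fact (m j))"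
    if "m \<in> partition_mults n n k" for m
  proof -
    have k: "(\<Sum>j=1..n. m j) = k" using that by (simp add: partition_mults_def)
    have "(\<Prod>j=1..n. sibuya \<alpha> j ^ m j / fact (m j)) =
        (\<Prod>j=1..n. \<alpha> ^ m j * ((pochhammer (1 - \<alpha>) (j - 1) / fact j) ^ m j * (1 / fact (m j))))"
      by (intro prod.cong) (auto simp: sibuya_def power_mult_distrib power_divide)
    also have "\<dots> = \<alpha> ^ k * (\<Prod>j=1..n. (pochhammer (1 - \<alpha>) (j - 1) / fact j) ^ m j * (1 / fact (m j)))"
      unfolding prod.distrib[of "\<lambda>j. \<alpha> ^ m j"] k[symmetric] power_sum ..
    finally show ?thesis using assms by (simp add: ep_prob_def)
  qed
  hence "(\<Sum>m\<in>partition_mults n n k. ep_prob \<alpha> \<theta> n m k) =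
     fact n * ep_ratio \<alpha> \<theta> n k / \<alpha> ^ k * (\<Sum>m\<in>partition_mults n n k. \<Prod>j=1..n. sibuya \<alpha> j ^ m j / fact (m j))"
    by (simp add: sum_distrib_left)
  thus ?thesis by (simp add: c types_weight_def)
qed

text \<open>Count the individuals twice, by type and by the multiplicity of their type.\<close>

lemma sum_mult_type_mult:
  fixes s :: "nat \<Rightarrow> 'c"
  shows "(\<Sum>l=1..n. l * type_mult n s l) = n"
proof -
  define g where "g c = card {i \<in> {1..n}. s i = c}" for c
  define T where "T = s ` {1..n}"
  have gT: "g ` T \<subseteq> {1..n}"
  proof
    fix l assume "l \<in> g ` T"
    then obtain i where i: "i \<in> {1..n}" "l = g (s i)" by (auto simp: T_def)
    have "g (s i) \<le> card {1..n}" unfolding g_def by (intro card_mono) auto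
    moreover have "g (s i) > 0" using i by (auto simp: g_def card_gt_0_iff)
    ultimately show "l \<in> {1..n}" using i by auto
  qed
  have mult: "type_mult n s l = card {c \<in> T. g c = l}" if "l \<in> {1..n}" for l
  proof -
    have "c \<in> T" if "g c = l" for c
    proof -
      have "0 < card {i \<in> {1..n}. s i = c}" using that \<open>l \<in> {1..n}\<close> by (simp add: g_def)
      hence "{i \<in> {1..n}. s i = c} \<noteq> {}" by (metis card.empty less_irrefl)
      thus ?thesis unfolding T_def by blast
    qed
    thus ?thesis unfolding type_mult_def g_def[symmetric] by (intro arg_cong[where f = card]) auto
  qed
  have "(\<Sum>l=1..n. l * type_mult n s l) = (\<Sum>l\<in>{1..n}. \<Sum>c\<in>{c \<in> T. g c = l}. g c)"
    by (intro sum.cong refl) (simp add: mult)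
  also have "\<dots> = (\<Sum>c\<in>T. g c)"
    by (rule sum.group) (use gT in \<open>auto simp: T_def\<close>)
  also have "\<dots> = (\<Sum>c\<in>T. \<Sum>i\<in>{i \<in> {1..n}. s i = c}. 1)"
    by (simp add: g_def)
  also have "\<dots> = (\<Sum>i\<in>{1..n}. 1)"
    by (rule sum.group) (auto simp: T_def)
  finally show ?thesis by simp
qed

text \<open>The vector of multiplicities of a sample is a partition of \<open>n\<close> into \<open>K\<^sub>n\<close> parts; hence the event is the
  finite disjoint union of the events whose probabilities the model prescribes.\<close>

theorem measure_num_types_ge:
  assumes \<alpha>: "0 < \<alpha>" and samp: "ewens_pitman_sample \<alpha> \<theta> n P X"
  shows "measure P {\<omega> \<in> space P. real (num_types n (\<lambda>i. X i \<omega>)) \<ge> y} =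
    (\<Sum>k | k \<le> n \<and> y \<le> real k. types_weight \<alpha> \<theta> n k * conv_pow (sibuya \<alpha>) k n)"
proof -
  interpret prob_space P using samp by (simp add: ewens_pitman_sample_def)
  define M where "M \<omega> l = type_mult n (\<lambda>i. X i \<omega>) l" for \<omega> l
  have meas: "(\<lambda>\<omega>. M \<omega> l) \<in> measurable P (count_space UNIV)" if "l \<in> {1..n}" for l
    using samp that by (simp add: ewens_pitman_sample_def M_def)
  define Kn where "Kn \<omega> = num_types n (\<lambda>i. X i \<omega>)" for \<omega>
  have Kn: "Kn \<omega> = (\<Sum>l=1..n. M \<omega> l)" for \<omega> by (simp add: Kn_def num_types_def M_def)
  have sumM: "(\<Sum>l=1..n. l * M \<omega> l) = n" for \<omega> unfolding M_def by (rule sum_mult_type_mult)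
  have Kn_le: "Kn \<omega> \<le> n" for \<omega>
  proof -
    have "Kn \<omega> \<le> (\<Sum>l=1..n. l * M \<omega> l)" unfolding Kn by (intro sum_mono) auto
    thus ?thesis by (simp only: sumM)
  qed
  define J where "J = {k. k \<le> n \<and> y \<le> real k}"
  define S where "S = Sigma J (partition_mults n n)"
  define A where "A = (\<lambda>(k, m). {\<omega> \<in> space P. (\<forall>l\<in>{1..n}. M \<omega> l = m l) \<and> Kn \<omega> = k})"
  have finJ: "finite J" by (simp add: J_def)
  have finS: "finite S" unfolding S_def using finJ by (intro finite_SigmaI finite_partition_mults)
  have prob_A: "prob (A (k, m)) = ep_prob \<alpha> \<theta> n m k" if "m \<in> partition_mults n n k" for k m
    using samp[unfolded ewens_pitman_sample_def, THEN conjunct2, THEN conjunct2, rule_format, of m k] that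
    by (simp only: A_def M_def Kn_def partition_mults_def prod.case mem_Collect_eq)
  have "{\<omega> \<in> space P. real (Kn \<omega>) \<ge> y} = (\<Union>q\<in>S. A q)"
  proof (intro equalityI subsetI)
    fix \<omega> assume w: "\<omega> \<in> {\<omega> \<in> space P. real (Kn \<omega>) \<ge> y}"
    define m where "m l = (if l \<in> {1..n} then M \<omega> l else 0)" for l
    have "(\<Sum>l=1..n. m l) = (\<Sum>l=1..n. M \<omega> l)" "(\<Sum>l=1..n. l * m l) = (\<Sum>l=1..n. l * M \<omega> l)"
      by (auto simp: m_def)
    hence "m \<in> partition_mults n n (Kn \<omega>)"
      using sumM[of \<omega>] Kn[of \<omega>] by (auto simp: partition_mults_def m_def)
    hence "(Kn \<omega>, m) \<in> S" using w Kn_le[of \<omega>] by (auto simp: S_def J_def)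
    moreover have "\<omega> \<in> A (Kn \<omega>, m)" using w by (auto simp: A_def m_def)
    ultimately show "\<omega> \<in> (\<Union>q\<in>S. A q)" by blast
  qed (auto simp: A_def S_def J_def)
  moreover have "prob (\<Union>q\<in>S. A q) = (\<Sum>q\<in>S. prob (A q))"
  proof (rule finite_measure_finite_Union)
    have "A (k, m) \<in> sets P" if m: "m \<in> partition_mults n n k" for k m
    proof -
      have "A (k, m) = {\<omega> \<in> space P. \<forall>l\<in>{1..n}. M \<omega> l = m l}"
        using m by (auto simp: A_def Kn partition_mults_def)
      also have "\<dots> \<in> sets P"
      proof (rule sets.sets_Collect_finite_All)
        fix l assume "l \<in> {1..n}"
        from measurable_sets[OF meas[OF this], of "{m l}"]
        show "{\<omega> \<in> space P. M \<omega> l = m l} \<in> sets P"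
          by (simp add: vimage_def Int_def conj_commute)
      qed simp
      finally show ?thesis .
    qed
    thus "A ` S \<subseteq> sets P" by (auto simp: S_def)
    show "disjoint_family_on A S"
      unfolding disjoint_family_on_def
    proof (intro ballI impI)
      fix q r assume q: "q \<in> S" and r: "r \<in> S" and ne: "q \<noteq> r"
      show "A q \<inter> A r = {}"
      proof (rule ccontr)
        assume "A q \<inter> A r \<noteq> {}"
        then obtain \<omega> where w: "\<omega> \<in> A q" "\<omega> \<in> A r" by blast
        have "fst q = fst r" using w by (auto simp: A_def split: prod.splits)
        moreover have "snd q l = snd r l" for l
        proof (cases "l \<in> {1..n}")
          case True
          then show ?thesis using w by (auto simp: A_def split: prod.splits)
        next
          case False
          then show ?thesis using q r by (auto simp: S_def partition_mults_def)
        qed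
        ultimately show False using ne by (metis ext prod.expand)
      qed
    qed
  qed (fact finS)
  moreover have "(\<Sum>q\<in>S. prob (A q)) = (\<Sum>k\<in>J. \<Sum>m\<in>partition_mults n n k. ep_prob \<alpha> \<theta> n m k)"
    unfolding S_def using finJ
    by (subst sum.Sigma) (auto simp: finite_partition_mults prob_A intro!: sum.cong)
  ultimately show ?thesis
    using sum_ep_prob[OF \<alpha>] by (simp add: Kn_def J_def)
qed

section \<open>Tilting the Sibuya law and the saddle point\<close>

text \<open>The operator \<open>y \<cdot> d/dy\<close> multiplies the \<open>n\<close>-th coefficient by \<open>n\<close>. Applied once and twice to the
  generating function it yields the first two moments.\<close>

lemma sums_times_index:
  fixes c :: "nat \<Rightarrow> real" and F :: "real \<Rightarrow> real"
  assumes F: "\<And>y. \<bar>y\<bar> < 1 \<Longrightarrow> (\<lambda>n. c n * y ^ n) sums F y"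
    and y: "\<bar>y\<bar> < 1" and D: "(F has_real_derivative D) (at y)"
  shows "(\<lambda>n. real n * c n * y ^ n) sums (y * D)"
proof -
  have sm: "summable (\<lambda>n. c n * y ^ n)" if "norm y < 1" for y
    using F[of y] that by (simp add: sums_iff)
  have "((\<lambda>y. \<Sum>n. c n * y ^ n) has_real_derivative (\<Sum>n. diffs c n * y ^ n)) (at y)"
    by (rule termdiffs_strong'[of 1]) (use sm y in auto)
  moreover have "eventually (\<lambda>t. t \<in> {-1<..<1}) (nhds y)"
    using y by (intro eventually_nhds_in_open) auto
  hence ev: "eventually (\<lambda>t. (\<Sum>n. c n * t ^ n) = F t) (nhds y)"
    by eventually_elim (use F in \<open>auto simp: sums_iff\<close>)
  ultimately have "(F has_real_derivative (\<Sum>n. diffs c n * y ^ n)) (at y)"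
    using DERIV_cong_ev[OF refl ev refl] by simp
  with D have "(\<Sum>n. diffs c n * y ^ n) = D" by (metis DERIV_unique)
  moreover have "summable (\<lambda>n. diffs c n * y ^ n)"
    by (rule termdiff_converges[of _ 1]) (use sm y in auto)
  hence "(\<lambda>n. of_nat n * c n * y ^ (n - Suc 0)) sums (\<Sum>n. diffs c n * y ^ n)"
    by (rule diffs_equiv)
  ultimately have "(\<lambda>n. y * (of_nat n * c n * y ^ (n - Suc 0))) sums (y * D)"
    by (intro sums_mult) simp
  moreover have "y * (of_nat n * c n * y ^ (n - Suc 0)) = real n * c n * y ^ n" for n
    by (cases n) auto
  ultimately show ?thesis by simp
qed

lemma summable_index_power:
  fixes c :: "nat \<Rightarrow> real"
  assumes "\<And>y. \<bar>y\<bar> < 1 \<Longrightarrow> summable (\<lambda>n. c n * y ^ n)" "\<bar>y\<bar> < 1"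
  shows "summable (\<lambda>n. real n ^ i * c n * y ^ n)"
  using assms(2)
proof (induction i arbitrary: y)
  case (Suc i)
  have "summable (\<lambda>n. diffs (\<lambda>n. real n ^ i * c n) n * y ^ n)"
    by (rule termdiff_converges[of _ 1]) (use Suc in auto)
  hence "summable (\<lambda>n. of_nat n * (real n ^ i * c n) * y ^ (n - Suc 0))"
    using diffs_equiv sums_summable by blast
  hence "summable (\<lambda>n. y * (of_nat n * (real n ^ i * c n) * y ^ (n - Suc 0)))"
    by (rule summable_mult)
  moreover have "y * (of_nat n * (real n ^ i * c n) * y ^ (n - Suc 0)) = real n ^ Suc i * c n * y ^ n" for n
    by (cases n) auto
  ultimately show ?case by simp
qed (use assms in simp)

definition sibuya_gf :: "real \<Rightarrow> real \<Rightarrow> real" where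
  "sibuya_gf \<alpha> z = 1 - (1 - z) powr \<alpha>"

text \<open>Closed forms of the mean and the variance of the tilted law: with \<open>D = z \<cdot> d/dz\<close>, the first two moments
  are \<open>D F / F\<close> and \<open>D (D F) / F\<close>.\<close>

definition tilted_mean :: "real \<Rightarrow> real \<Rightarrow> real" where
  "tilted_mean \<alpha> z = \<alpha> * z * (1 - z) powr (\<alpha> - 1) / sibuya_gf \<alpha> z"

definition tilted_var :: "real \<Rightarrow> real \<Rightarrow> real" where
  "tilted_var \<alpha> z = z * (\<alpha> * (1 - z) powr (\<alpha> - 1) + \<alpha> * z * (1 - \<alpha>) * (1 - z) powr (\<alpha> - 2)) / sibuya_gf \<alpha> z
     - (tilted_mean \<alpha> z)\<^sup>2"

definition tilted_sibuya :: "real \<Rightarrow> real \<Rightarrow> nat \<Rightarrow> real" where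
  "tilted_sibuya \<alpha> z j = sibuya \<alpha> j * z ^ j / sibuya_gf \<alpha> z"

text \<open>In a product of \<open>k\<close> weights with index sum \<open>n\<close> the tilting factors multiply to \<open>z^n / F(z)^k\<close>, whatever
  the indices are.\<close>

lemma conv_pow_tilted:
  assumes "sibuya_gf \<alpha> z \<noteq> 0"
  shows "conv_pow (sibuya \<alpha>) k n * z ^ n = sibuya_gf \<alpha> z ^ k * conv_pow (tilted_sibuya \<alpha> z) k n"
proof (induction k arbitrary: n)
  case (Suc k)
  have "conv_pow (sibuya \<alpha>) (Suc k) n * z ^ n
      = (\<Sum>i\<le>n. (sibuya \<alpha> i * z ^ i) * (conv_pow (sibuya \<alpha>) k (n - i) * z ^ (n - i)))"
    unfolding conv_pow_Suc sum_distrib_right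
    by (intro sum.cong refl) (simp add: power_add[symmetric] mult_ac)
  also have "\<dots> = (\<Sum>i\<le>n. (sibuya \<alpha> i * z ^ i) * (sibuya_gf \<alpha> z ^ k * conv_pow (tilted_sibuya \<alpha> z) k (n - i)))"
    by (simp only: Suc.IH)
  also have "\<dots> = sibuya_gf \<alpha> z ^ Suc k * conv_pow (tilted_sibuya \<alpha> z) (Suc k) n"
    unfolding conv_pow_Suc sum_distrib_left
    by (intro sum.cong refl) (use assms in \<open>simp add: tilted_sibuya_def\<close>)
  finally show ?case .
qed (simp add: conv_pow_0)

locale sibuya_index =
  fixes \<alpha> :: real
  assumes \<alpha>: "0 < \<alpha>" "\<alpha> < 1"
begin

lemma sibuya_nonneg: "0 \<le> sibuya \<alpha> j"
  using \<alpha> by (auto simp: sibuya_def intro!: divide_nonneg_pos mult_nonneg_nonneg pochhammer_nonneg)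

text \<open>The binomial series of \<open>(1 - z)\<^sup>\<alpha>\<close>, whose coefficients of positive index are the negatives of the
  Sibuya weights.\<close>

lemma sibuya_sums:
  assumes "\<bar>z\<bar> < 1"
  shows "(\<lambda>j. sibuya \<alpha> j * z ^ j) sums sibuya_gf \<alpha> z"
proof -
  have "(\<lambda>j. (\<alpha> gchoose j) * (- z) ^ j) sums (1 + - z) powr \<alpha>"
    by (rule gen_binomial_real) (use assms in auto)
  moreover have "(\<lambda>j. if j = 0 then 1 else 0 :: real) sums 1"
    using sums_single[of 0 "\<lambda>_. 1::real"] by simp
  ultimately have "(\<lambda>j. (if j = 0 then 1 else 0) - (\<alpha> gchoose j) * (- z) ^ j) sums sibuya_gf \<alpha> z"
    unfolding sibuya_gf_def by (intro sums_diff) auto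
  moreover have "(if j = 0 then 1 else 0) - (\<alpha> gchoose j) * (- z) ^ j = sibuya \<alpha> j * z ^ j" for j
  proof (cases j)
    case (Suc i)
    have "(- 1) ^ j * (- z) ^ j = z ^ j" by (simp flip: power_mult_distrib)
    hence "(\<alpha> gchoose j) * (- z) ^ j = pochhammer (- \<alpha>) j / fact j * z ^ j"
      by (simp add: gbinomial_pochhammer mult_ac)
    thus ?thesis using Suc by (simp add: sibuya_def pochhammer_rec)
  qed (simp add: sibuya_def)
  ultimately show ?thesis by simp
qed

lemma gf_bounds: "0 < z \<Longrightarrow> z < 1 \<Longrightarrow> 0 < sibuya_gf \<alpha> z \<and> sibuya_gf \<alpha> z < 1"
  using \<alpha> powr_less_mono2[of \<alpha> "1 - z" 1] by (auto simp: sibuya_gf_def)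

lemma DERIV_gf: "z < 1 \<Longrightarrow> (sibuya_gf \<alpha> has_real_derivative \<alpha> * (1 - z) powr (\<alpha> - 1)) (at z)"
  unfolding sibuya_gf_def[abs_def] by (auto intro!: derivative_eq_intros)

lemma first_moment_sums:
  assumes "\<bar>z\<bar> < 1"
  shows "(\<lambda>j. real j * sibuya \<alpha> j * z ^ j) sums (\<alpha> * z * (1 - z) powr (\<alpha> - 1))"
  using sums_times_index[OF sibuya_sums assms DERIV_gf] assms by (simp add: mult_ac)

lemma DERIV_first_moment:
  "z < 1 \<Longrightarrow> ((\<lambda>z. \<alpha> * z * (1 - z) powr (\<alpha> - 1)) has_real_derivative
     (\<alpha> * (1 - z) powr (\<alpha> - 1) + \<alpha> * z * (1 - \<alpha>) * (1 - z) powr (\<alpha> - 2))) (at z)"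
  by (auto intro!: derivative_eq_intros simp: algebra_simps)

lemma second_moment_sums:
  assumes "\<bar>z\<bar> < 1"
  shows "(\<lambda>j. (real j)\<^sup>2 * sibuya \<alpha> j * z ^ j) sums
    (z * (\<alpha> * (1 - z) powr (\<alpha> - 1) + \<alpha> * z * (1 - \<alpha>) * (1 - z) powr (\<alpha> - 2)))"
  using sums_times_index[OF first_moment_sums assms DERIV_first_moment] assms
  by (simp add: mult_ac power2_eq_square)

lemma tilted_sibuya_nonneg:
  assumes "0 < z" "z < 1"
  shows "0 \<le> tilted_sibuya \<alpha> z m"
  using gf_bounds[OF assms] assms
  by (auto simp: tilted_sibuya_def intro!: divide_nonneg_pos mult_nonneg_nonneg sibuya_nonneg)

lemma lattice_law_tilted:
  assumes z: "0 < z" "z < 1"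
  shows "lattice_law (tilted_sibuya \<alpha> z) (tilted_mean \<alpha> z) (tilted_var \<alpha> z)"
proof
  have gf: "sibuya_gf \<alpha> z > 0" using gf_bounds z by blast
  have z': "\<bar>z\<bar> < 1" using z by simp
  show "0 \<le> tilted_sibuya \<alpha> z m" for m by (rule tilted_sibuya_nonneg[OF z])
  show total: "tilted_sibuya \<alpha> z sums 1"
    using sums_divide[OF sibuya_sums[OF z'], of "sibuya_gf \<alpha> z"] gf by (simp add: tilted_sibuya_def[abs_def])
  show "0 < tilted_sibuya \<alpha> z 1" "0 < tilted_sibuya \<alpha> z 2"
    using gf z \<alpha> by (auto simp: tilted_sibuya_def sibuya_def)
  show mean: "(\<lambda>m. real m * tilted_sibuya \<alpha> z m) sums tilted_mean \<alpha> z"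
    using sums_divide[OF first_moment_sums[OF z'], of "sibuya_gf \<alpha> z"]
    by (simp add: tilted_sibuya_def tilted_mean_def mult_ac)
  have second: "(\<lambda>m. (real m)\<^sup>2 * tilted_sibuya \<alpha> z m) sums (tilted_var \<alpha> z + (tilted_mean \<alpha> z)\<^sup>2)"
    using sums_divide[OF second_moment_sums[OF z'], of "sibuya_gf \<alpha> z"]
    by (simp add: tilted_sibuya_def tilted_var_def mult_ac)
  have "(\<lambda>m. (real m)\<^sup>2 * tilted_sibuya \<alpha> z m - 2 * tilted_mean \<alpha> z * (real m * tilted_sibuya \<alpha> z m)
          + (tilted_mean \<alpha> z)\<^sup>2 * tilted_sibuya \<alpha> z m)
      sums (tilted_var \<alpha> z + (tilted_mean \<alpha> z)\<^sup>2 - 2 * tilted_mean \<alpha> z * tilted_mean \<alpha> z + (tilted_mean \<alpha> z)\<^sup>2 * 1)"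
    by (intro sums_add sums_diff sums_mult second mean total)
  thus "(\<lambda>m. (real m - tilted_mean \<alpha> z)\<^sup>2 * tilted_sibuya \<alpha> z m) sums tilted_var \<alpha> z"
    by (simp add: power2_eq_square algebra_simps)
  have m4: "summable (\<lambda>m. real m ^ 4 * tilted_sibuya \<alpha> z m)"
    using summable_divide[OF summable_index_power[of "sibuya \<alpha>" z 4], of "sibuya_gf \<alpha> z"] sibuya_sums z'
    by (simp add: tilted_sibuya_def mult_ac sums_iff)
  show "summable (\<lambda>m. (real m - tilted_mean \<alpha> z) ^ 4 * tilted_sibuya \<alpha> z m)"
  proof (rule summable_comparison_test)
    show "summable (\<lambda>m. 8 * (real m ^ 4 * tilted_sibuya \<alpha> z m) + 8 * tilted_mean \<alpha> z ^ 4 * tilted_sibuya \<alpha> z m)"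
      using total by (intro summable_add summable_mult m4) (auto simp: sums_iff)
    have ineq: "(a - b) ^ 4 \<le> 8 * a ^ 4 + 8 * b ^ 4" for a b :: real
    proof -
      have "(a - b)\<^sup>2 \<le> 2 * (a\<^sup>2 + b\<^sup>2)"
        using zero_le_power2[of "a + b"] by (simp add: power2_eq_square algebra_simps)
      hence "((a - b)\<^sup>2)\<^sup>2 \<le> (2 * (a\<^sup>2 + b\<^sup>2))\<^sup>2" by (intro power_mono) auto
      also have "\<dots> \<le> 8 * (a\<^sup>2)\<^sup>2 + 8 * (b\<^sup>2)\<^sup>2"
        using zero_le_power2[of "a\<^sup>2 - b\<^sup>2"] by (simp add: power2_sum power2_diff power_mult_distrib)
      finally show ?thesis by (simp flip: power_mult)
    qed
    have "norm ((real m - tilted_mean \<alpha> z) ^ 4 * tilted_sibuya \<alpha> z m)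
        \<le> 8 * (real m ^ 4 * tilted_sibuya \<alpha> z m) + 8 * tilted_mean \<alpha> z ^ 4 * tilted_sibuya \<alpha> z m" for m
    proof -
      note nn = tilted_sibuya_nonneg[OF z]
      have "norm ((real m - tilted_mean \<alpha> z) ^ 4 * tilted_sibuya \<alpha> z m) = (real m - tilted_mean \<alpha> z) ^ 4 * tilted_sibuya \<alpha> z m"
        using nn by (simp add: abs_mult)
      also have "\<dots> \<le> (8 * real m ^ 4 + 8 * tilted_mean \<alpha> z ^ 4) * tilted_sibuya \<alpha> z m"
        by (intro mult_right_mono ineq nn)
      finally show ?thesis by (simp add: algebra_simps)
    qed
    thus "\<exists>N. \<forall>m\<ge>N. norm ((real m - tilted_mean \<alpha> z) ^ 4 * tilted_sibuya \<alpha> z m)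
        \<le> 8 * (real m ^ 4 * tilted_sibuya \<alpha> z m) + 8 * tilted_mean \<alpha> z ^ 4 * tilted_sibuya \<alpha> z m" by blast
  qed
qed

lemma tilted_var_pos: "0 < z \<Longrightarrow> z < 1 \<Longrightarrow> 0 < tilted_var \<alpha> z"
  using lattice_law.variance_pos[OF lattice_law_tilted] .

text \<open>The familiar fact that in an exponential family the derivative of the mean in the natural
  parameter, here \<open>ln z\<close>, is the variance. It makes the mean strictly increasing, which gives uniqueness
  of the saddle point.\<close>

lemma DERIV_tilted_mean:
  assumes z: "0 < z" "z < 1"
  shows "(tilted_mean \<alpha> has_real_derivative tilted_var \<alpha> z / z) (at z)"
proof -
  have gf: "sibuya_gf \<alpha> z > 0" using gf_bounds z by blast
  have "(tilted_mean \<alpha> has_real_derivative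
      ((\<alpha> * (1 - z) powr (\<alpha> - 1) + \<alpha> * z * (1 - \<alpha>) * (1 - z) powr (\<alpha> - 2)) * sibuya_gf \<alpha> z
       - \<alpha> * z * (1 - z) powr (\<alpha> - 1) * (\<alpha> * (1 - z) powr (\<alpha> - 1))) / (sibuya_gf \<alpha> z * sibuya_gf \<alpha> z)) (at z)"
    unfolding tilted_mean_def[abs_def]
    by (rule DERIV_divide[OF DERIV_first_moment DERIV_gf]) (use z gf in auto)
  moreover have "((A * g - \<alpha> * z * p * (\<alpha> * p)) / (g * g)) = (z * A / g - (\<alpha> * z * p / g)\<^sup>2) / z"
    if "g > 0" for A g p :: real using that z by (simp add: field_simps power2_eq_square)
  ultimately show ?thesis unfolding tilted_var_def tilted_mean_def[of \<alpha> z] using gf by simp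
qed

lemma tilted_mean_strict_mono:
  assumes "0 < a" "a < b" "b < 1"
  shows "tilted_mean \<alpha> a < tilted_mean \<alpha> b"
proof (rule DERIV_pos_imp_increasing[OF assms(2)])
  fix t assume "a \<le> t" "t \<le> b"
  hence t: "0 < t" "t < 1" using assms by auto
  thus "\<exists>y. (tilted_mean \<alpha> has_real_derivative y) (at t) \<and> 0 < y"
    using DERIV_tilted_mean[OF t] tilted_var_pos[OF t] by (intro exI[of _ "tilted_var \<alpha> t / t"] conjI) auto
qed

lemma tilted_mean_less_iff:
  assumes "0 < a" "a < 1" "0 < b" "b < 1"
  shows "tilted_mean \<alpha> a < tilted_mean \<alpha> b \<longleftrightarrow> a < b"
  using tilted_mean_strict_mono[of a b] tilted_mean_strict_mono[of b a] assms
  by (metis less_asym less_linear less_irrefl)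

text \<open>The mean tends to 1, the smallest atom, as \<open>z \<rightarrow> 0\<close>, and to infinity as \<open>z \<rightarrow> 1\<close>, since the Sibuya law
  itself has infinite mean.\<close>

lemma tilted_mean_surj:
  assumes "1 < y"
  shows "\<exists>z. 0 < z \<and> z < 1 \<and> tilted_mean \<alpha> z = y"
proof -
  have "((\<lambda>z. \<alpha> * z * (1 - z) powr (\<alpha> - 1) / (1 - (1 - z) powr \<alpha>)) \<longlongrightarrow> 1) (at_right 0)"
    using \<alpha> by real_asymp
  hence "eventually (\<lambda>z. tilted_mean \<alpha> z < y) (at_right 0)"
    unfolding tilted_mean_def sibuya_gf_def using assms by (rule order_tendstoD)
  moreover have "eventually (\<lambda>z::real. z \<in> {0<..<1}) (at_right 0)"
    by (rule eventually_at_right_real) auto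
  ultimately have "eventually (\<lambda>z. tilted_mean \<alpha> z < y \<and> z \<in> {0<..<1}) (at_right 0)" by (rule eventually_conj)
  then obtain a where a: "tilted_mean \<alpha> a < y" "0 < a" "a < 1"
    using eventually_happens'[OF trivial_limit_at_right_real] by fastforce
  have "filterlim (\<lambda>z. \<alpha> * z * (1 - z) powr (\<alpha> - 1) / (1 - (1 - z) powr \<alpha>)) at_top (at_left 1)"
    using \<alpha> by real_asymp
  hence "eventually (\<lambda>z. tilted_mean \<alpha> z > y) (at_left 1)"
    unfolding tilted_mean_def sibuya_gf_def by (simp add: filterlim_at_top_dense)
  moreover have "eventually (\<lambda>z::real. z \<in> {0<..<1}) (at_left 1)"
    by (rule eventually_at_left_real) auto
  ultimately have "eventually (\<lambda>z. tilted_mean \<alpha> z > y \<and> z \<in> {0<..<1}) (at_left 1)" by (rule eventually_conj)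
  then obtain b where b: "tilted_mean \<alpha> b > y" "0 < b" "b < 1"
    using eventually_happens'[OF trivial_limit_at_left_real] by fastforce
  have ab: "a < b" using a b tilted_mean_less_iff[of a b] by auto
  have "\<exists>z. a \<le> z \<and> z \<le> b \<and> tilted_mean \<alpha> z = y"
  proof (rule IVT')
    show "continuous_on {a..b} (tilted_mean \<alpha>)"
      using a b by (intro DERIV_continuous_on[OF DERIV_subset[OF DERIV_tilted_mean]]) auto
  qed (use a b ab in auto)
  then obtain z where "a \<le> z" "z \<le> b" "tilted_mean \<alpha> z = y" by blast
  thus ?thesis using a b by (intro exI[of _ z]) auto
qed

lemma DERIV_h:
  assumes z: "0 < z" "z < 1"
  shows "(h \<alpha> x has_real_derivative (1 - x * tilted_mean \<alpha> z) / z) (at z)"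
proof -
  have gf: "sibuya_gf \<alpha> z > 0" using gf_bounds z by blast
  have "((\<lambda>z. ln z - x * ln (sibuya_gf \<alpha> z)) has_real_derivative
      1 / z - x * (1 / sibuya_gf \<alpha> z * (\<alpha> * (1 - z) powr (\<alpha> - 1)))) (at z)"
    by (rule derivative_eq_intros refl DERIV_gf z gf | simp add: z)+
  moreover have "(\<lambda>z. ln z - x * ln (sibuya_gf \<alpha> z)) = h \<alpha> x" by (simp add: h_def fun_eq_iff sibuya_gf_def)
  moreover have "1 / z - x * (1 / sibuya_gf \<alpha> z * (\<alpha> * (1 - z) powr (\<alpha> - 1))) = (1 - x * tilted_mean \<alpha> z) / z"
    using z gf by (simp add: tilted_mean_def field_simps)
  ultimately show ?thesis by simp
qed

text \<open>By \<open>DERIV_h\<close>, critical points of \<open>h\<close> are the points where the tilted mean is \<open>1/x\<close>.\<close>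

lemma saddle:
  assumes x: "0 < x" "x < 1"
  shows "0 < z_root \<alpha> x" "z_root \<alpha> x < 1" "tilted_mean \<alpha> (z_root \<alpha> x) = 1 / x"
proof -
  have *: "deriv (h \<alpha> x) z = 0 \<longleftrightarrow> tilted_mean \<alpha> z = 1 / x" if "0 < z" "z < 1" for z
    using DERIV_imp_deriv[OF DERIV_h[OF that, of x]] x that by (auto simp: field_simps)
  have ex: "\<exists>!z. 0 < z \<and> z < 1 \<and> deriv (h \<alpha> x) z = 0"
  proof -
    obtain z where z: "0 < z" "z < 1" "tilted_mean \<alpha> z = 1 / x"
      using tilted_mean_surj[of "1 / x"] x by auto
    show ?thesis
    proof (rule ex1I[of _ z])
      show "0 < z \<and> z < 1 \<and> deriv (h \<alpha> x) z = 0" using z * by auto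
      show "u = z" if "0 < u \<and> u < 1 \<and> deriv (h \<alpha> x) u = 0" for u
        using that z * tilted_mean_less_iff[of u z] tilted_mean_less_iff[of z u] by (metis less_irrefl linorder_neqE)
    qed
  qed
  from theI'[OF ex] have "0 < z_root \<alpha> x \<and> z_root \<alpha> x < 1 \<and> deriv (h \<alpha> x) (z_root \<alpha> x) = 0"
    by (simp add: z_root_def)
  thus "0 < z_root \<alpha> x" "z_root \<alpha> x < 1" "tilted_mean \<alpha> (z_root \<alpha> x) = 1 / x" using * by auto
qed

text \<open>Only the derivative of the tilted mean survives, because \<open>1 - x \<cdot> tilted_mean \<alpha> z\<close> vanishes at the saddle
  point.\<close>

lemma second_deriv_h_saddle:
  assumes x: "0 < x" "x < 1"
  shows "deriv (deriv (h \<alpha> x)) (z_root \<alpha> x) = - x * tilted_var \<alpha> (z_root \<alpha> x) / (z_root \<alpha> x)\<^sup>2"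
proof -
  define z where "z = z_root \<alpha> x"
  have z: "0 < z" "z < 1" "tilted_mean \<alpha> z = 1 / x" using saddle[OF x] by (auto simp: z_def)
  have "((\<lambda>z. (1 - x * tilted_mean \<alpha> z) / z) has_real_derivative
      ((0 - x * (tilted_var \<alpha> z / z)) * z - (1 - x * tilted_mean \<alpha> z) * 1) / (z * z)) (at z)"
    by (intro DERIV_divide DERIV_diff DERIV_const DERIV_cmult DERIV_tilted_mean DERIV_ident) (use z in auto)
  moreover have "((0 - x * (tilted_var \<alpha> z / z)) * z - (1 - x * tilted_mean \<alpha> z) * 1) / (z * z)
      = - x * tilted_var \<alpha> z / z\<^sup>2"
    using z x by (simp add: power2_eq_square)
  moreover have "eventually (\<lambda>t. t \<in> {0<..<1}) (nhds z)"
    using z by (intro eventually_nhds_in_open) auto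
  hence ev: "eventually (\<lambda>t. deriv (h \<alpha> x) t = (1 - x * tilted_mean \<alpha> t) / t) (nhds z)"
    by eventually_elim (auto intro!: DERIV_imp_deriv DERIV_h)
  ultimately have "(deriv (h \<alpha> x) has_real_derivative - x * tilted_var \<alpha> z / z\<^sup>2) (at z)"
    using DERIV_cong_ev[OF refl ev refl] by simp
  thus ?thesis unfolding z_def by (rule DERIV_imp_deriv)
qed

text \<open>On the real axis the saddle point is the global maximum of \<open>h\<close>: the sign of the derivative is that of
  \<open>1 - x \<cdot> tilted_mean \<alpha> z\<close>, which is decreasing in \<open>z\<close>.\<close>

lemma h_le_rate:
  assumes x: "0 < x" "x < 1" and z: "0 < z" "z < 1"
  shows "h \<alpha> x z \<le> rate \<alpha> x"
proof -
  define r where "r = z_root \<alpha> x"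
  have r: "0 < r" "r < 1" "tilted_mean \<alpha> r = 1 / x" using saddle[OF x] by (auto simp: r_def)
  show ?thesis
  proof (cases "z \<le> r")
    case True
    have "h \<alpha> x z \<le> h \<alpha> x r"
    proof (rule DERIV_nonneg_imp_nondecreasing[OF True])
      fix t assume t: "z \<le> t" "t \<le> r"
      have "tilted_mean \<alpha> t \<le> 1 / x"
        using t z r tilted_mean_less_iff[of r t] by auto
      hence "x * tilted_mean \<alpha> t \<le> 1" using x by (simp add: field_simps)
      thus "\<exists>y. (h \<alpha> x has_real_derivative y) (at t) \<and> 0 \<le> y"
        using t z r by (intro exI[of _ "(1 - x * tilted_mean \<alpha> t) / t"] conjI DERIV_h) auto
    qed
    thus ?thesis by (simp add: rate_def r_def)
  next
    case False
    hence le: "r \<le> z" by simp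
    have "h \<alpha> x r \<ge> h \<alpha> x z"
    proof (rule DERIV_nonpos_imp_nonincreasing[OF le])
      fix t assume t: "r \<le> t" "t \<le> z"
      have "tilted_mean \<alpha> t \<ge> 1 / x"
        using t z r tilted_mean_less_iff[of t r] by auto
      hence "x * tilted_mean \<alpha> t \<ge> 1" using x by (simp add: field_simps)
      thus "\<exists>y. (h \<alpha> x has_real_derivative y) (at t) \<and> y \<le> 0"
        using t z r by (intro exI[of _ "(1 - x * tilted_mean \<alpha> t) / t"] conjI DERIV_h divide_nonpos_pos) auto
    qed
    thus ?thesis by (simp add: rate_def r_def)
  qed
qed

text \<open>The saddle point is the inverse of a strictly increasing function at \<open>1/x\<close>, hence continuous in \<open>x\<close>.\<close>

lemma z_root_tendsto:
  assumes x: "0 < x" "x < 1"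
  shows "(z_root \<alpha> \<longlongrightarrow> z_root \<alpha> x) (at x)"
proof (rule order_tendstoI)
  have "eventually (\<lambda>y. y \<in> {0<..<1}) (at x)"
    using x by (intro eventually_at_in_open') auto
  hence ev: "eventually (\<lambda>y. 0 < y \<and> y < 1) (at x)" by simp
  have inv: "((\<lambda>y. 1 / y) \<longlongrightarrow> 1 / x) (at x)" using x by (intro tendsto_intros) auto
  fix a
  {
    assume a: "a < z_root \<alpha> x"
    show "eventually (\<lambda>y. a < z_root \<alpha> y) (at x)"
    proof (cases "a \<le> 0")
      case True
      show ?thesis using ev by eventually_elim (use True saddle(1) in fastforce)
    next
      case False
      hence a1: "0 < a" "a < 1" using a saddle(2)[OF x] by auto
      have "tilted_mean \<alpha> a < 1 / x"
        using a a1 saddle[OF x] tilted_mean_strict_mono[of a "z_root \<alpha> x"] by simp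
      from order_tendstoD(1)[OF inv this] ev show ?thesis
        by eventually_elim (use a1 saddle tilted_mean_less_iff in metis)
    qed
  }
  {
    assume a: "a > z_root \<alpha> x"
    show "eventually (\<lambda>y. a > z_root \<alpha> y) (at x)"
    proof (cases "a \<ge> 1")
      case True
      show ?thesis using ev by eventually_elim (use True saddle(2) in fastforce)
    next
      case False
      hence a1: "0 < a" "a < 1" using a saddle(1)[OF x] by auto
      have "tilted_mean \<alpha> a > 1 / x"
        using a a1 saddle[OF x] tilted_mean_strict_mono[of "z_root \<alpha> x" a] by simp
      from order_tendstoD(2)[OF inv this] ev show ?thesis
        by eventually_elim (use a1 saddle tilted_mean_less_iff in metis)
    qed
  }
qed

lemma h_diff: "h \<alpha> y z - h \<alpha> x z = (y - x) * (- ln (sibuya_gf \<alpha> z))"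
  by (simp add: h_def sibuya_gf_def algebra_simps)

text \<open>Envelope argument. Since \<open>h\<close> is affine in \<open>x\<close> and the rate is its maximum over \<open>z\<close>, the difference
  quotient between \<open>x\<close> and \<open>y\<close> lies between the slopes at the maximisers \<open>z(x)\<close> and \<open>z(y)\<close>. As the
  saddle point is continuous in \<open>x\<close>, the two slopes have the same limit.\<close>

lemma DERIV_rate:
  assumes x: "0 < x" "x < 1"
  shows "(rate \<alpha> has_real_derivative - ln (sibuya_gf \<alpha> (z_root \<alpha> x))) (at x)"
proof -
  define L where "L y = - ln (sibuya_gf \<alpha> (z_root \<alpha> y))" for y
  have "(L \<longlongrightarrow> L x) (at x)"
  proof -
    have "isCont (sibuya_gf \<alpha>) (z_root \<alpha> x)" using DERIV_gf[OF saddle(2)[OF x]] by (rule DERIV_isCont)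
    from isCont_tendsto_compose[OF this z_root_tendsto[OF x]]
    have "((\<lambda>y. sibuya_gf \<alpha> (z_root \<alpha> y)) \<longlongrightarrow> sibuya_gf \<alpha> (z_root \<alpha> x)) (at x)" .
    thus ?thesis unfolding L_def using gf_bounds[OF saddle(1,2)[OF x]] by (intro tendsto_intros) auto
  qed
  hence lim: "((\<lambda>y. L y - L x) \<longlongrightarrow> 0) (at x)" by (simp add: LIM_zero_iff)
  have "eventually (\<lambda>y. y \<in> {0<..<1} - {x}) (at x)"
    using x by (intro eventually_at_in_open) auto
  hence "eventually (\<lambda>y. norm ((rate \<alpha> y - rate \<alpha> x) / (y - x) - L x) \<le> norm (L y - L x)) (at x)"
  proof eventually_elim
    case (elim y)
    hence y: "0 < y" "y < 1" "y \<noteq> x" by auto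
    have "h \<alpha> y (z_root \<alpha> x) - h \<alpha> x (z_root \<alpha> x) \<le> rate \<alpha> y - rate \<alpha> x"
      using h_le_rate[OF y(1,2) saddle(1,2)[OF x]] by (simp add: rate_def)
    hence 1: "(y - x) * L x \<le> rate \<alpha> y - rate \<alpha> x" unfolding h_diff L_def .
    have "rate \<alpha> y - rate \<alpha> x \<le> h \<alpha> y (z_root \<alpha> y) - h \<alpha> x (z_root \<alpha> y)"
      using h_le_rate[OF x saddle(1,2)[OF y(1,2)]] by (simp add: rate_def)
    hence 2: "rate \<alpha> y - rate \<alpha> x \<le> (y - x) * L y" unfolding h_diff L_def .
    define D where "D = rate \<alpha> y - rate \<alpha> x - (y - x) * L x"
    have D: "0 \<le> D" "D \<le> (y - x) * (L y - L x)" using 1 2 by (auto simp: D_def algebra_simps)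
    have "(rate \<alpha> y - rate \<alpha> x) / (y - x) - L x = D / (y - x)"
      using y by (simp add: D_def field_simps)
    hence "norm ((rate \<alpha> y - rate \<alpha> x) / (y - x) - L x) = D / \<bar>y - x\<bar>"
      using D by simp
    also have "\<dots> \<le> \<bar>(y - x) * (L y - L x)\<bar> / \<bar>y - x\<bar>"
      using D y by (intro divide_right_mono) auto
    also have "\<dots> = norm (L y - L x)" using y by (simp add: abs_mult)
    finally show ?case .
  qed
  from Lim_null_comparison[OF this tendsto_norm_zero[OF lim]]
  have "((\<lambda>y. (rate \<alpha> y - rate \<alpha> x) / (y - x)) \<longlongrightarrow> L x) (at x)" by (simp add: LIM_zero_iff)
  thus ?thesis by (simp add: has_field_derivative_iff L_def)
qed

end

section \<open>Ratios of rising factorials with an error term\<close>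

text \<open>The finitely many indices before the estimate sets in are absorbed into the constant.\<close>

lemma bigo_sequentially_bound:
  fixes f g :: "nat \<Rightarrow> real"
  assumes "f \<in> O(g)" and g: "\<And>n. n \<ge> 1 \<Longrightarrow> 0 < g n"
  shows "\<exists>C\<ge>0. \<forall>n\<ge>1. \<bar>f n\<bar> \<le> C * g n"
proof -
  obtain c N where c: "c > 0" and N: "\<And>n. n \<ge> N \<Longrightarrow> norm (f n) \<le> c * norm (g n)"
  proof -
    obtain c where "c > 0" "eventually (\<lambda>n. norm (f n) \<le> c * norm (g n)) sequentially"
      using assms(1) by (rule landau_o.bigE)
    thus thesis using that by (auto simp: eventually_sequentially)
  qed
  define C where "C = c + (\<Sum>i<N. \<bar>f i\<bar> / \<bar>g i\<bar>)"
  have "\<bar>f n\<bar> \<le> C * g n" if n: "n \<ge> 1" for n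
  proof (cases "n \<ge> N")
    case True
    have "\<bar>f n\<bar> \<le> c * g n" using N[OF True] g[OF n] by simp
    also have "\<dots> \<le> C * g n" using g[OF n] by (intro mult_right_mono) (auto simp: C_def sum_nonneg)
    finally show ?thesis .
  next
    case False
    have "\<bar>f n\<bar> = (\<bar>f n\<bar> / \<bar>g n\<bar>) * g n" using g[OF n] by simp
    also have "\<bar>f n\<bar> / \<bar>g n\<bar> \<le> (\<Sum>i<N. \<bar>f i\<bar> / \<bar>g i\<bar>)"
      using False by (intro member_le_sum) auto
    also have "\<dots> \<le> C" using c by (simp add: C_def)
    finally show ?thesis using g[OF n] by simp
  qed
  moreover have "C \<ge> 0" using c by (auto simp: C_def intro!: add_nonneg_nonneg sum_nonneg)
  ultimately show ?thesis by blast
qed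

text \<open>Telescoping, with \<open>1/k\<^sup>2 \<le> 2 (1/k - 1/(k + 1))\<close>.\<close>

lemma summable_increments_rate:
  fixes r :: "nat \<Rightarrow> real"
  assumes lim: "r \<longlonglongrightarrow> L" and inc: "\<And>n. n \<ge> 1 \<Longrightarrow> \<bar>r (Suc n) - r n\<bar> \<le> B / (real n)\<^sup>2"
    and n: "n \<ge> 1"
  shows "\<bar>L - r n\<bar> \<le> 2 * B / real n"
proof -
  have B: "B \<ge> 0" using inc[of 1] by simp
  have tel: "\<bar>r (n + m) - r n\<bar> \<le> 2 * B * (1 / real n - 1 / real (n + m))" for m
  proof (induction m)
    case (Suc m)
    define k where "k = n + m"
    have k: "k \<ge> 1" using n by (simp add: k_def)
    have "1 / (real k)\<^sup>2 \<le> 2 * (1 / real k - 1 / real (Suc k))"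
    proof -
      have "real k * real (Suc k) \<le> 2 * (real k)\<^sup>2" using k by (simp add: power2_eq_square algebra_simps)
      hence "2 / (2 * (real k)\<^sup>2) \<le> 2 / (real k * real (Suc k))" using k by (intro divide_left_mono) auto
      moreover have "1 / real k - 1 / real (Suc k) = 1 / (real k * real (Suc k))" using k by (simp add: field_simps)
      ultimately show ?thesis by simp
    qed
    from mult_left_mono[OF this B] have "B / (real k)\<^sup>2 \<le> 2 * B * (1 / real k - 1 / real (Suc k))"
      by (simp add: mult.assoc mult.left_commute[of 2 B] del: of_nat_Suc)
    moreover have "\<bar>r (n + Suc m) - r n\<bar> \<le> \<bar>r (Suc k) - r k\<bar> + \<bar>r (n + m) - r n\<bar>"
      by (simp add: k_def)
    ultimately show ?case using Suc inc[OF k] by (simp add: k_def algebra_simps)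
  qed simp
  have "(\<lambda>m. \<bar>r (n + m) - r n\<bar>) \<longlonglongrightarrow> \<bar>L - r n\<bar>"
    using LIMSEQ_ignore_initial_segment[OF lim, of n] by (intro tendsto_intros) (simp add: add.commute)
  moreover have "\<bar>r (n + m) - r n\<bar> \<le> 2 * B / real n" for m
  proof -
    have "2 * B * (1 / real n - 1 / real (n + m)) \<le> 2 * B * (1 / real n)"
      using B by (intro mult_left_mono) auto
    with tel[of m] show ?thesis by simp
  qed
  ultimately show ?thesis by (intro LIMSEQ_le_const2) auto
qed

text \<open>The limit is Euler's product formula for the Gamma function. For the rate, the quotient of
  consecutive terms is \<open>1 + O(1/n\<^sup>2)\<close> and the sequence is bounded, so its increments are \<open>O(1/n\<^sup>2)\<close>.\<close>

lemma pochhammer_over_fact_asymp: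
  fixes a :: real
  assumes a: "a \<notin> \<int>\<^sub>\<le>\<^sub>0"
  shows "\<exists>C\<ge>0. \<forall>n\<ge>1. \<bar>pochhammer a n / fact n * real n powr (1 - a) * Gamma a - 1\<bar> \<le> C / real n"
proof -
  define r where "r n = pochhammer a n / fact n * real n powr (1 - a)" for n
  define g where "g n = (a + real n) / (real n + 1) * ((real n + 1) / real n) powr (1 - a)" for n :: nat
  have rg: "r (Suc n) = r n * g n" if n: "n \<ge> 1" for n
  proof -
    have "real (Suc n) powr (1 - a) = real n powr (1 - a) * ((real n + 1) / real n) powr (1 - a)"
      using n by (simp add: powr_divide add.commute)
    thus ?thesis using n by (simp add: r_def g_def pochhammer_Suc field_simps)
  qed
  have "(\<lambda>n. rGamma_series a n * (real n / (a + real n))) \<longlonglongrightarrow> rGamma a * 1"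
    by (intro tendsto_mult rGamma_series_LIMSEQ) real_asymp
  moreover have "eventually (\<lambda>n. rGamma_series a n * (real n / (a + real n)) = r n) sequentially"
  proof -
    have ev: "eventually (\<lambda>n. a + real n > 0) sequentially" by real_asymp
    show ?thesis using ev eventually_gt_at_top[of 0]
    proof eventually_elim
      case (elim n)
      have "exp (a * ln (real n)) = real n powr a" using elim by (simp add: powr_def)
      moreover have "real n powr (1 - a) = real n / real n powr a" using elim by (simp add: powr_diff)
      ultimately show ?case using elim
        by (simp add: rGamma_series_def r_def pochhammer_Suc divide_simps)
    qed
  qed
  ultimately have lim: "r \<longlonglongrightarrow> rGamma a" by (simp add: tendsto_cong)
  have "(\<lambda>n. g n - 1) \<in> O(\<lambda>n. 1 / (real n)\<^sup>2)" unfolding g_def by real_asymp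
  then obtain C where C: "C \<ge> 0" "\<And>n. n \<ge> 1 \<Longrightarrow> \<bar>g n - 1\<bar> \<le> C * (1 / (real n)\<^sup>2)"
    using bigo_sequentially_bound[of "\<lambda>n. g n - 1" "\<lambda>n. 1 / (real n)\<^sup>2"] by auto
  obtain B where B: "B > 0" "\<And>n. \<bar>r n\<bar> \<le> B"
    using convergent_imp_Bseq[OF convergentI[OF lim]] by (auto simp: Bseq_def)
  have inc: "\<bar>r (Suc n) - r n\<bar> \<le> B * C / (real n)\<^sup>2" if n: "n \<ge> 1" for n
  proof -
    have "\<bar>r (Suc n) - r n\<bar> = \<bar>r n\<bar> * \<bar>g n - 1\<bar>"
      by (simp add: rg[OF n] algebra_simps flip: abs_mult)
    also have "\<dots> \<le> B * (C * (1 / (real n)\<^sup>2))" using B C(2)[OF n] by (intro mult_mono) auto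
    finally show ?thesis by simp
  qed
  have G: "Gamma a \<noteq> 0" using a by (simp add: Gamma_eq_zero_iff)
  have "\<bar>r n * Gamma a - 1\<bar> \<le> (2 * B * C * \<bar>Gamma a\<bar>) / real n" if n: "n \<ge> 1" for n
  proof -
    have "r n * Gamma a - 1 = - ((rGamma a - r n) * Gamma a)"
      using G by (simp add: rGamma_inverse_Gamma algebra_simps)
    hence "\<bar>r n * Gamma a - 1\<bar> = \<bar>rGamma a - r n\<bar> * \<bar>Gamma a\<bar>" by (simp add: abs_mult)
    also have "\<dots> \<le> (2 * (B * C) / real n) * \<bar>Gamma a\<bar>"
      by (intro mult_right_mono summable_increments_rate[OF lim inc n]) auto
    finally show ?thesis by simp
  qed
  thus ?thesis using B C by (intro exI[of _ "2 * B * C * \<bar>Gamma a\<bar>"]) (auto simp: r_def)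
qed

lemma not_nonpos_Int_gt_minus_1:
  fixes y :: real
  assumes "y > -1" "y \<noteq> 0"
  shows "y \<notin> \<int>\<^sub>\<le>\<^sub>0"
proof
  assume "y \<in> \<int>\<^sub>\<le>\<^sub>0"
  then obtain i where i: "y = - real i" by (elim nonpos_Ints_cases') auto
  hence "real i < 1" "i \<noteq> 0" using assms by auto
  thus False by simp
qed

text \<open>For \<open>\<theta> \<noteq> 0\<close> the weight is the quotient of \<open>(\<theta>/\<alpha>)\<^sub>k / k!\<close> and \<open>(\<theta>)\<^sub>n / n!\<close>, where \<open>(a)\<^sub>k\<close> is the
  rising factorial; neither parameter is a pole of
  the Gamma function, as both exceed \<open>-1\<close>. For \<open>\<theta> = 0\<close> the cancelled weight is exactly \<open>n / (\<alpha> k)\<close>.\<close>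

lemma types_weight_asymp:
  assumes \<alpha>: "0 < \<alpha>" "\<alpha> < 1" and \<theta>: "\<theta> > - \<alpha>"
  shows "\<exists>C\<ge>0. \<forall>n\<ge>1. \<forall>k\<ge>1.
    \<bar>types_weight \<alpha> \<theta> n k / (Gamma_ratio \<alpha> \<theta> * real k powr (\<theta> / \<alpha> - 1) * real n powr (1 - \<theta>)) - 1\<bar>
      \<le> C * (1 / real k + 1 / real n)"
proof (cases "\<theta> = 0")
  case True
  have "types_weight \<alpha> \<theta> n k / (Gamma_ratio \<alpha> \<theta> * real k powr (\<theta> / \<alpha> - 1) * real n powr (1 - \<theta>)) = 1"
    if n: "n \<ge> 1" and k: "k \<ge> 1" for n k
  proof -
    obtain k' n' where Suc: "k = Suc k'" "n = Suc n'" using n k by (metis not0_implies_Suc not_one_le_zero)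
    have "(\<Prod>i=2..Suc l. (real i - 1) * \<alpha>) = \<alpha> ^ l * fact l" for l
    proof (induction l)
      case (Suc l)
      have "{2..Suc (Suc l)} = insert (Suc (Suc l)) {2..Suc l}" by auto
      moreover have "Suc (Suc l) \<notin> {2..Suc l}" by auto
      ultimately have "(\<Prod>i=2..Suc (Suc l). (real i - 1) * \<alpha>)
          = (real (Suc (Suc l)) - 1) * \<alpha> * (\<Prod>i=2..Suc l. (real i - 1) * \<alpha>)"
        by (simp only:) (subst prod.insert, simp_all)
      also have "\<dots> = (real (Suc (Suc l)) - 1) * \<alpha> * (\<alpha> ^ l * fact l)" by (simp only: Suc)
      finally show ?case by (simp add: algebra_simps)
    qed simp
    hence "(\<Prod>i=2..k. \<theta> + (real i - 1) * \<alpha>) = \<alpha> ^ k' * fact k'"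
      by (simp only: True Suc add_0)
    hence "types_weight \<alpha> \<theta> n k = fact n * (\<alpha> ^ k' * fact k' / fact n') / (fact k * \<alpha> ^ k)"
      using True Suc by (simp only: types_weight_def ep_ratio_def) (simp add: pochhammer_fact[symmetric])
    also have "\<dots> = real n / (real k * \<alpha>)"
      using \<alpha> Suc(1,2) by (simp add: divide_simps)
    finally have "types_weight \<alpha> \<theta> n k = real n / (real k * \<alpha>)" .
    moreover have "real k powr (\<theta> / \<alpha> - 1) = 1 / real k" using True k by (simp add: powr_minus_divide)
    ultimately show ?thesis using True \<alpha> n k by (simp add: Gamma_ratio_def)
  qed
  thus ?thesis by (intro exI[of _ 0] conjI allI impI) (simp_all only: order_refl diff_self abs_zero mult_zero_left)
next
  case False
  define a where "a = \<theta> / \<alpha>"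
  define u where "u k = pochhammer a k / fact k * real k powr (1 - a) * Gamma a" for k
  define v where "v n = pochhammer \<theta> n / fact n * real n powr (1 - \<theta>) * Gamma \<theta>" for n
  have aG: "a \<notin> \<int>\<^sub>\<le>\<^sub>0" using not_nonpos_Int_gt_minus_1[of a] False \<alpha> \<theta> by (simp add: a_def field_simps)
  have tG: "\<theta> \<notin> \<int>\<^sub>\<le>\<^sub>0" using not_nonpos_Int_gt_minus_1[of \<theta>] False \<alpha> \<theta> by simp
  obtain C where C: "C \<ge> 0" "\<And>k. k \<ge> 1 \<Longrightarrow> \<bar>u k - 1\<bar> \<le> C / real k"
    using pochhammer_over_fact_asymp[OF aG] unfolding u_def by blast
  obtain D where D: "D \<ge> 0" "\<And>n. n \<ge> 1 \<Longrightarrow> \<bar>v n - 1\<bar> \<le> D / real n"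
    using pochhammer_over_fact_asymp[OF tG] unfolding v_def by blast
  have v0: "v n \<noteq> 0" if "n \<ge> 1" for n
  proof -
    have "pochhammer \<theta> n \<noteq> 0" using tG pochhammer_eq_0_imp_nonpos_Int by blast
    moreover have "Gamma \<theta> \<noteq> 0" using tG by (simp add: Gamma_eq_zero_iff)
    ultimately show ?thesis using that by (simp add: v_def)
  qed
  have "(\<lambda>n. v n - 1) \<longlonglongrightarrow> 0"
  proof (rule Lim_null_comparison)
    show "eventually (\<lambda>n. norm (v n - 1) \<le> D / real n) sequentially"
      using eventually_ge_at_top[of 1] by eventually_elim (use D in auto)
  qed real_asymp
  hence "v \<longlonglongrightarrow> 1" by (simp add: LIM_zero_iff)
  hence "(\<lambda>n. 1 / v n) \<longlonglongrightarrow> 1 / 1" by (intro tendsto_intros) auto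
  hence "Bseq (\<lambda>n. 1 / v n)" by (intro convergent_imp_Bseq convergentI)
  then obtain B where B: "B > 0" "\<And>n. \<bar>1 / v n\<bar> \<le> B"
    unfolding Bseq_def real_norm_def by blast
  have "\<bar>types_weight \<alpha> \<theta> n k / (Gamma_ratio \<alpha> \<theta> * real k powr (\<theta> / \<alpha> - 1) * real n powr (1 - \<theta>)) - 1\<bar>
      \<le> (B * (C + D)) * (1 / real k + 1 / real n)" if n: "n \<ge> 1" and k: "k \<ge> 1" for n k
  proof -
    have "(\<Prod>i=1..k. \<theta> + (real i - 1) * \<alpha>) = \<alpha> ^ k * pochhammer a k"
    proof (induction k)
      case (Suc l)
      then show ?case using \<alpha> by (simp add: pochhammer_Suc a_def field_simps)
    qed simp
    hence tw: "types_weight \<alpha> \<theta> n k = (pochhammer a k / fact k) / (pochhammer \<theta> n / fact n)"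
      using False \<alpha> by (simp add: types_weight_def ep_ratio_def mult_ac)
    have "real k powr (1 - a) = 1 / real k powr (a - 1)"
      using powr_minus_divide[of "real k" "a - 1"] by simp
    hence eq: "types_weight \<alpha> \<theta> n k / (Gamma_ratio \<alpha> \<theta> * real k powr (\<theta> / \<alpha> - 1) * real n powr (1 - \<theta>)) = u k / v n"
      using False aG tG by (simp add: tw u_def v_def Gamma_ratio_def a_def[symmetric] Gamma_eq_zero_iff mult_ac)
    have "\<bar>types_weight \<alpha> \<theta> n k / (Gamma_ratio \<alpha> \<theta> * real k powr (\<theta> / \<alpha> - 1) * real n powr (1 - \<theta>)) - 1\<bar>
        = \<bar>(u k - 1) - (v n - 1)\<bar> * \<bar>1 / v n\<bar>"
    proof -
      have "u k / v n - 1 = ((u k - 1) - (v n - 1)) * (1 / v n)" using v0[OF n] by (simp add: field_simps)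
      thus ?thesis using eq by (simp only: abs_mult)
    qed
    also have "\<dots> \<le> (C / real k + D / real n) * B"
      using C(2)[OF k] D(2)[OF n] B by (intro mult_mono) auto
    also have "\<dots> \<le> ((C + D) / real k + (C + D) / real n) * B"
      using C D B by (intro mult_right_mono add_mono divide_right_mono) auto
    finally show ?thesis by (simp add: field_simps)
  qed
  thus ?thesis using B C D by (intro exI[of _ "B * (C + D)"]) auto
qed

section \<open>The tail of the number of types\<close>

lemma powr_lipschitz_at_1:
  fixes b R :: real
  assumes "1 \<le> R"
  shows "\<exists>D\<ge>0. \<forall>s. 1 \<le> s \<and> s \<le> R \<longrightarrow> \<bar>s powr b - 1\<bar> \<le> D * (s - 1)"
proof -
  define D where "D = \<bar>b\<bar> * R powr \<bar>b - 1\<bar>"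
  have "\<bar>s powr b - 1\<bar> \<le> D * (s - 1)" if s: "1 \<le> s" "s \<le> R" for s
  proof (cases "s = 1")
    case False
    with s have "1 < s" by simp
    then obtain \<xi> where \<xi>: "1 < \<xi>" "\<xi> < s" "s powr b - 1 powr b = (s - 1) * (b * \<xi> powr (b - 1))"
      using MVT2[of 1 s "\<lambda>t. t powr b" "\<lambda>t. b * t powr (b - 1)"] by (force intro!: derivative_eq_intros)
    have "\<xi> powr (b - 1) \<le> \<xi> powr \<bar>b - 1\<bar>" using \<xi> by (intro powr_mono) auto
    also have "\<dots> \<le> R powr \<bar>b - 1\<bar>" using \<xi> s by (intro powr_mono2) auto
    finally have "\<bar>b\<bar> * \<xi> powr (b - 1) \<le> D" unfolding D_def by (intro mult_left_mono) auto
    hence "(s - 1) * (\<bar>b\<bar> * \<xi> powr (b - 1)) \<le> (s - 1) * D" using s by (intro mult_left_mono) auto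
    thus ?thesis using \<xi>(3) s by (simp add: abs_mult mult_ac)
  qed simp
  thus ?thesis by (intro exI[of _ D]) (auto simp: D_def)
qed

lemma abs_triple_product_minus_1:
  fixes a b c A B C :: real
  assumes "\<bar>a\<bar> \<le> A" "\<bar>b\<bar> \<le> B"
  shows "\<bar>a * b * c - 1\<bar> \<le> A * B * \<bar>c - 1\<bar> + A * \<bar>b - 1\<bar> + \<bar>a - 1\<bar>"
proof -
  have "a * b * c - 1 = a * b * (c - 1) + a * (b - 1) + (a - 1)" by (simp add: algebra_simps)
  hence "\<bar>a * b * c - 1\<bar> \<le> \<bar>a\<bar> * \<bar>b\<bar> * \<bar>c - 1\<bar> + \<bar>a\<bar> * \<bar>b - 1\<bar> + \<bar>a - 1\<bar>"
    by (simp add: abs_mult[symmetric])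
  also have "\<dots> \<le> A * B * \<bar>c - 1\<bar> + A * \<bar>b - 1\<bar> + \<bar>a - 1\<bar>"
    using assms by (intro add_mono mult_right_mono mult_mono) auto
  finally show ?thesis .
qed

text \<open>The numbers \<open>(1 - f) f^j\<close> are the weights of a probability law, whose second moment is finite.\<close>

lemma geometric_average_error:
  fixes f :: real and e :: "nat \<Rightarrow> nat \<Rightarrow> real"
  assumes f: "0 < f" "f < 1"
    and e: "\<And>n j. n \<ge> 1 \<Longrightarrow> \<bar>e n j - 1\<bar> \<le> C * (1 + real j)\<^sup>2 / real n"
  shows "\<exists>C'. \<forall>n\<ge>1. \<bar>(1 - f) * (\<Sum>j. f ^ j * e n j) - 1\<bar> \<le> C' / real n"
proof -
  have sq: "summable (\<lambda>j. f ^ j * (1 + real j)\<^sup>2)"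
  proof -
    have "\<bar>f\<bar> < 1" using f by simp
    hence "summable (\<lambda>j. real j ^ i * 1 * f ^ j)" for i
      by (intro summable_index_power) (auto intro: summable_geometric)
    hence s: "summable (\<lambda>j. real j ^ i * f ^ j)" for i by simp
    have "summable (\<lambda>j. real j ^ 0 * f ^ j + 2 * (real j ^ 1 * f ^ j) + real j ^ 2 * f ^ j)"
      by (intro summable_add summable_mult s)
    thus ?thesis by (simp add: power2_eq_square algebra_simps)
  qed
  define S where "S = (\<Sum>j. f ^ j * (1 + real j)\<^sup>2)"
  have "\<bar>(1 - f) * (\<Sum>j. f ^ j * e n j) - 1\<bar> \<le> (1 - f) * C * S / real n" if n: "n \<ge> 1" for n
  proof -
    have bound: "norm (f ^ j * (e n j - 1)) \<le> C / real n * (f ^ j * (1 + real j)\<^sup>2)" for j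
    proof -
      have "norm (f ^ j * (e n j - 1)) = f ^ j * \<bar>e n j - 1\<bar>" using f by (simp add: abs_mult)
      also have "\<dots> \<le> f ^ j * (C * (1 + real j)\<^sup>2 / real n)" using f e[OF n] by (intro mult_left_mono) auto
      finally show ?thesis by (simp add: mult_ac)
    qed
    have sm: "summable (\<lambda>j. f ^ j * (e n j - 1))"
      by (rule summable_comparison_test[OF _ summable_mult[OF sq, of "C / real n"]]) (use bound in blast)
    have geo: "(\<lambda>j. f ^ j) sums (1 / (1 - f))" using f by (intro geometric_sums) auto
    have "(\<lambda>j. f ^ j * (e n j - 1) + f ^ j) sums ((\<Sum>j. f ^ j * (e n j - 1)) + 1 / (1 - f))"
      by (intro sums_add summable_sums sm geo)
    hence "(\<Sum>j. f ^ j * e n j) = (\<Sum>j. f ^ j * (e n j - 1)) + 1 / (1 - f)"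
      by (simp add: algebra_simps sums_iff)
    hence "(1 - f) * (\<Sum>j. f ^ j * e n j) - 1 = (1 - f) * (\<Sum>j. f ^ j * (e n j - 1))"
      using f by (simp add: field_simps)
    hence "\<bar>(1 - f) * (\<Sum>j. f ^ j * e n j) - 1\<bar> = (1 - f) * norm (\<Sum>j. f ^ j * (e n j - 1))"
      using f by (simp add: abs_mult)
    also have "\<dots> \<le> (1 - f) * (\<Sum>j. C / real n * (f ^ j * (1 + real j)\<^sup>2))"
      using f by (intro mult_left_mono norm_suminf_le bound summable_mult sq) auto
    also have "\<dots> = (1 - f) * C * S / real n"
      using suminf_mult[OF sq, of "C / real n"] by (simp add: S_def)
    finally show ?thesis .
  qed
  thus ?thesis by blast
qed

locale ewens_pitman_tail = sibuya_index +
  fixes \<theta> x :: real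
  assumes \<theta>: "\<theta> > - \<alpha>" and x: "0 < x" "x < 1"
begin

abbreviation "z \<equiv> z_root \<alpha> x"
abbreviation "f \<equiv> sibuya_gf \<alpha> z"
abbreviation "v \<equiv> tilted_var \<alpha> z"
abbreviation "q \<equiv> conv_pow (tilted_sibuya \<alpha> z)"

text \<open>The approximation of \<open>P(K\<^sub>n = k)\<close> for \<open>k\<close> near \<open>xn\<close>, without its exponential part \<open>F(z)^k z^(-n)\<close>.\<close>

definition term_scale :: "nat \<Rightarrow> real" where
  "term_scale n = Gamma_ratio \<alpha> \<theta> * (x * real n) powr (\<theta> / \<alpha> - 1) * real n powr (1 - \<theta>) / sqrt (2 * pi * (x * real n) * v)"

definition term_ratio :: "nat \<Rightarrow> nat \<Rightarrow> real" where
  "term_ratio n k = types_weight \<alpha> \<theta> n k * q k n / term_scale n"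

lemma z: "0 < z" "z < 1" and mean_z: "tilted_mean \<alpha> z = 1 / x"
  using saddle[OF x] by auto

lemma f: "0 < f" "f < 1" using gf_bounds z by auto

lemma v: "0 < v" using tilted_var_pos z by blast

lemma Gamma_ratio_nonzero: "Gamma_ratio \<alpha> \<theta> \<noteq> 0"
proof (cases "\<theta> = 0")
  case False
  have "\<theta> / \<alpha> \<notin> \<int>\<^sub>\<le>\<^sub>0" "\<theta> \<notin> \<int>\<^sub>\<le>\<^sub>0"
    using not_nonpos_Int_gt_minus_1[of "\<theta> / \<alpha>"] not_nonpos_Int_gt_minus_1[of \<theta>] False \<alpha> \<theta> by (auto simp: field_simps)
  thus ?thesis using False by (simp add: Gamma_ratio_def Gamma_eq_zero_iff)
qed (use \<alpha> in \<open>simp add: Gamma_ratio_def\<close>)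

text \<open>The ratio is a product of three factors close to 1: the error in the rising factorials, the
  replacement of \<open>k\<close> by \<open>xn\<close> in the power of \<open>k\<close>, and the local limit theorem. All are within
  \<open>O((1 + j)\<^sup>2 / n)\<close> of 1, and the first two are bounded because \<open>xn \<le> k \<le> n\<close>; the third need not be
  bounded, so it is the one whose error is multiplied by the other two.\<close>

lemma term_ratio_error:
  "\<exists>C\<ge>0. \<forall>n\<ge>1. \<forall>k\<le>n. \<forall>j. x * real n \<le> real k \<and> real k \<le> x * real n + (1 + real j) \<longrightarrow>
     \<bar>term_ratio n k - 1\<bar> \<le> C * (1 + real j)\<^sup>2 / real n"
proof -
  define b where "b = \<theta> / \<alpha> - 1"
  obtain C1 where C1: "C1 \<ge> 0" "\<And>n k. n \<ge> 1 \<Longrightarrow> k \<ge> 1 \<Longrightarrow>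
    \<bar>types_weight \<alpha> \<theta> n k / (Gamma_ratio \<alpha> \<theta> * real k powr b * real n powr (1 - \<theta>)) - 1\<bar>
      \<le> C1 * (1 / real k + 1 / real n)"
    using types_weight_asymp[OF \<alpha> \<theta>] unfolding b_def by blast
  obtain C2 where C2: "C2 \<ge> 0" "\<And>s. 1 \<le> s \<Longrightarrow> s \<le> 1 / x \<Longrightarrow> \<bar>s powr b - 1\<bar> \<le> C2 * (s - 1)"
    using powr_lipschitz_at_1[of "1 / x" b] x by auto
  obtain C3 where C3: "C3 \<ge> 0" "\<And>s. 1 \<le> s \<Longrightarrow> s \<le> 1 / x \<Longrightarrow> \<bar>s powr (- 1 / 2) - 1\<bar> \<le> C3 * (s - 1)"
    using powr_lipschitz_at_1[of "1 / x" "- 1 / 2"] x by auto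
  obtain C4' where C4': "\<And>k n. k \<ge> 1 \<Longrightarrow>
     \<bar>q k n - 1 / sqrt (2 * pi * real k * v)\<bar> \<le> C4' * (1 + \<bar>real k * (1 / x) - real n\<bar>)\<^sup>2 / (real k * sqrt (real k))"
    using lattice_law.local_limit[OF lattice_law_tilted[OF z]] unfolding mean_z by blast
  define C4 where "C4 = \<bar>C4'\<bar>"
  have C4: "C4 \<ge> 0" "\<And>k n. k \<ge> 1 \<Longrightarrow>
     \<bar>q k n - 1 / sqrt (2 * pi * real k * v)\<bar> \<le> C4 * (1 + \<bar>real k * (1 / x) - real n\<bar>)\<^sup>2 / (real k * sqrt (real k))"
  proof -
    fix k n :: nat assume "k \<ge> 1"
    note C4'[OF this, of n]
    also have "C4' * (1 + \<bar>real k * (1 / x) - real n\<bar>)\<^sup>2 / (real k * sqrt (real k))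
      \<le> C4 * (1 + \<bar>real k * (1 / x) - real n\<bar>)\<^sup>2 / (real k * sqrt (real k))"
      by (intro divide_right_mono mult_right_mono) (auto simp: C4_def)
    finally show "\<bar>q k n - 1 / sqrt (2 * pi * real k * v)\<bar> \<le> C4 * (1 + \<bar>real k * (1 / x) - real n\<bar>)\<^sup>2 / (real k * sqrt (real k))" .
  qed (simp add: C4_def)
  define D1 where "D1 = C1 * (1 / x + 1)"
  define D2 where "D2 = C2 / x"
  define D3 where "D3 = sqrt (2 * pi * v) * C4 * (1 + 1 / x)\<^sup>2 / x + C3 / x"
  define A where "A = 1 + D1"
  define B where "B = 1 + C2 * (1 / x - 1)"
  have nn: "D1 \<ge> 0" "D2 \<ge> 0" "D3 \<ge> 0" "A \<ge> 0" "B \<ge> 0"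
    using C1 C2 C3 C4 x v by (auto simp: D1_def D2_def D3_def A_def B_def)
  have "\<bar>term_ratio n k - 1\<bar> \<le> (A * B * D3 + A * D2 + D1) * (1 + real j)\<^sup>2 / real n"
    if n: "n \<ge> 1" and kn: "k \<le> n" and xk: "x * real n \<le> real k" and kj: "real k \<le> x * real n + (1 + real j)"
    for n k j
  proof -
    define y where "y = x * real n"
    define s where "s = real k / y"
    define E where "E = (1 + real j)\<^sup>2 / real n"
    have y: "y > 0" using n x by (simp add: y_def)
    have k: "k \<ge> 1" using y xk by (cases k) (auto simp: y_def)
    have E1: "(1 + real j) / real n \<le> E"
      unfolding E_def by (intro divide_right_mono) (auto simp: power2_eq_square)
    have E0: "1 / real n \<le> E"
      using E1 divide_right_mono[of 1 "1 + real j" "real n"] by simp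
    have s: "1 \<le> s" "s \<le> 1 / x"
      using y xk kn x n by (auto simp: s_def y_def field_simps)
    have s1: "s - 1 \<le> (1 + real j) / real n / x"
    proof -
      have "s - 1 = (real k - y) / y" using y by (simp add: s_def field_simps)
      also have "\<dots> \<le> (1 + real j) / y" using kj y by (intro divide_right_mono) (auto simp: y_def)
      finally show ?thesis by (simp add: y_def mult.commute)
    qed
    define A1 where "A1 = types_weight \<alpha> \<theta> n k / (Gamma_ratio \<alpha> \<theta> * real k powr b * real n powr (1 - \<theta>))"
    define A2 where "A2 = s powr b"
    define A3 where "A3 = sqrt (2 * pi * y * v) * q k n"
    have A1': "\<bar>A1 - 1\<bar> \<le> D1 * (1 / real n)"
    proof -
      have "1 / real k \<le> 1 / y" using xk y by (intro divide_left_mono) (auto simp: y_def)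
      hence "1 / real k + 1 / real n \<le> (1 / x + 1) * (1 / real n)" by (simp add: y_def algebra_simps)
      from mult_left_mono[OF this C1(1)] C1(2)[OF n k] show ?thesis by (simp add: A1_def D1_def)
    qed
    have A1: "\<bar>A1 - 1\<bar> \<le> D1 * E" "\<bar>A1\<bar> \<le> A"
    proof -
      show "\<bar>A1 - 1\<bar> \<le> D1 * E" using A1' mult_left_mono[OF E0 nn(1)] by linarith
      have "1 / real n \<le> 1" using n by simp
      from mult_left_mono[OF this nn(1)] A1' show "\<bar>A1\<bar> \<le> A" by (simp add: A_def)
    qed
    have A2: "\<bar>A2 - 1\<bar> \<le> D2 * E" "\<bar>A2\<bar> \<le> B"
    proof -
      have le: "\<bar>A2 - 1\<bar> \<le> C2 * (s - 1)" unfolding A2_def using C2(2) s by blast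
      also have "\<dots> \<le> C2 * ((1 + real j) / real n / x)" using s1 C2 by (intro mult_left_mono) auto
      also have "\<dots> = D2 * ((1 + real j) / real n)" by (simp add: D2_def)
      also have "\<dots> \<le> D2 * E" using E1 nn by (intro mult_left_mono) auto
      finally show "\<bar>A2 - 1\<bar> \<le> D2 * E" .
      have "C2 * (s - 1) \<le> C2 * (1 / x - 1)" using s C2 by (intro mult_left_mono) auto
      with le show "\<bar>A2\<bar> \<le> B" by (simp add: B_def)
    qed
    have A3: "\<bar>A3 - 1\<bar> \<le> D3 * E"
    proof -
      have sq: "sqrt (2 * pi * y * v) = sqrt (2 * pi * v) * sqrt y" by (simp add: real_sqrt_mult)
      have root: "sqrt (2 * pi * y * v) / sqrt (2 * pi * real k * v) = s powr (- 1 / 2)"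
      proof -
        have "sqrt (2 * pi * y * v) / sqrt (2 * pi * real k * v) = sqrt (1 / s)"
          using v y k by (simp add: s_def real_sqrt_mult real_sqrt_divide)
        also have "\<dots> = s powr (- 1 / 2)"
          using s by (simp add: real_sqrt_divide powr_half_sqrt[symmetric] powr_minus_divide)
        finally show ?thesis .
      qed
      have "\<bar>A3 - s powr (- 1 / 2)\<bar> = sqrt (2 * pi * y * v) * \<bar>q k n - 1 / sqrt (2 * pi * real k * v)\<bar>"
        unfolding root[symmetric] A3_def using v y by (simp add: algebra_simps abs_mult_pos' flip: abs_mult)
      also have "\<dots> \<le> sqrt (2 * pi * y * v) * (C4 * (1 + \<bar>real k * (1 / x) - real n\<bar>)\<^sup>2 / (real k * sqrt (real k)))"
        using C4(2)[OF k] v y by (intro mult_left_mono) auto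
      also have "\<dots> \<le> (sqrt (2 * pi * v) * sqrt (real k)) * (C4 * ((1 + 1 / x) * (1 + real j))\<^sup>2 / (real k * sqrt (real k)))"
      proof -
        have "real k * (1 / x) - real n = (real k - y) / x" using x by (simp add: y_def field_simps)
        hence "\<bar>real k * (1 / x) - real n\<bar> \<le> (1 + real j) / x"
          using xk kj x by (auto simp: y_def abs_of_nonneg intro!: divide_right_mono)
        hence "1 + \<bar>real k * (1 / x) - real n\<bar> \<le> (1 + 1 / x) * (1 + real j)"
          by (simp add: algebra_simps add_divide_distrib)
        hence "(1 + \<bar>real k * (1 / x) - real n\<bar>)\<^sup>2 \<le> ((1 + 1 / x) * (1 + real j))\<^sup>2"
          by (intro power_mono) auto
        moreover have "sqrt (2 * pi * y * v) \<le> sqrt (2 * pi * v) * sqrt (real k)"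
          unfolding sq using xk v by (intro mult_left_mono) (auto simp: y_def)
        ultimately show ?thesis
          using C4(1) v by (intro mult_mono divide_right_mono mult_left_mono) auto
      qed
      also have "\<dots> = sqrt (2 * pi * v) * C4 * (1 + 1 / x)\<^sup>2 * (1 + real j)\<^sup>2 / real k"
        using k by (simp only: power_mult_distrib) simp
      also have "\<dots> \<le> sqrt (2 * pi * v) * C4 * (1 + 1 / x)\<^sup>2 * (1 + real j)\<^sup>2 / y"
        using xk y C4(1) v k by (intro divide_left_mono mult_nonneg_nonneg) (auto simp: y_def)
      also have "\<dots> = sqrt (2 * pi * v) * C4 * (1 + 1 / x)\<^sup>2 / x * E"
        by (simp add: E_def y_def)
      finally have 1: "\<bar>A3 - s powr (- 1 / 2)\<bar> \<le> sqrt (2 * pi * v) * C4 * (1 + 1 / x)\<^sup>2 / x * E" .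
      have "\<bar>s powr (- 1 / 2) - 1\<bar> \<le> C3 * (s - 1)" using C3(2) s by blast
      also have "\<dots> \<le> C3 * ((1 + real j) / real n / x)" using s1 C3 by (intro mult_left_mono) auto
      also have "\<dots> = C3 / x * ((1 + real j) / real n)" by simp
      also have "\<dots> \<le> C3 / x * E" using E1 C3 x by (intro mult_left_mono) auto
      finally have 2: "\<bar>s powr (- 1 / 2) - 1\<bar> \<le> C3 / x * E" .
      have "D3 * E = sqrt (2 * pi * v) * C4 * (1 + 1 / x)\<^sup>2 / x * E + C3 / x * E"
        unfolding D3_def by (rule distrib_right)
      with 1 2 show ?thesis by linarith
    qed
    have "term_ratio n k = A1 * A2 * A3"
    proof -
      have kp: "real k powr b = y powr b * s powr b"
        using y s by (simp add: s_def flip: powr_mult)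
      have "s powr b \<noteq> 0" "y powr b \<noteq> 0" using s y by auto
      thus ?thesis using Gamma_ratio_nonzero
        unfolding term_ratio_def term_scale_def A1_def A2_def A3_def y_def[symmetric] b_def[symmetric] kp
        by (simp add: field_simps)
    qed
    hence "\<bar>term_ratio n k - 1\<bar> \<le> A * B * \<bar>A3 - 1\<bar> + A * \<bar>A2 - 1\<bar> + \<bar>A1 - 1\<bar>"
      using abs_triple_product_minus_1[OF A1(2) A2(2)] by simp
    also have "\<dots> \<le> A * B * (D3 * E) + A * (D2 * E) + D1 * E"
      using A1 A2 A3 nn by (intro add_mono mult_left_mono) auto
    finally show ?thesis by (simp add: E_def algebra_simps add_divide_distrib)
  qed
  moreover have "A * B * D3 + A * D2 + D1 \<ge> 0" using nn by auto
  ultimately show ?thesis by blast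
qed

text \<open>The exponent is \<open>- n I(x) - (\<lceil>xn\<rceil> - xn) I'(x)\<close>. As \<open>I(x) = ln z - x ln F(z)\<close> and \<open>I'(x) = - ln F(z)\<close>, it
  equals \<open>\<lceil>xn\<rceil> ln F(z) - n ln z\<close>.\<close>

lemma tail_approx_eq:
  assumes n: "n \<ge> 1"
  shows "tail_approx \<alpha> \<theta> x n = term_scale n * (f ^ nat \<lceil>x * real n\<rceil> / z ^ n) / (1 - f)"
proof -
  define k0 where "k0 = nat \<lceil>x * real n\<rceil>"
  have k0: "real k0 = real n * x + ceil_frac (real n * x)"
    using x n by (simp add: k0_def ceil_frac_def mult.commute)
  have I': "deriv (rate \<alpha>) x = - ln f" by (rule DERIV_imp_deriv[OF DERIV_rate[OF x]])
  have "exp (- ceil_frac (real n * x) * deriv (rate \<alpha>) x) * exp (- real n * rate \<alpha> x)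
      = exp (real k0 * ln f - real n * ln z)"
    unfolding I' rate_def h_def k0 sibuya_gf_def[symmetric] by (simp add: algebra_simps flip: exp_add)
  also have "\<dots> = f ^ k0 / z ^ n"
    using f z by (simp add: exp_diff exp_of_nat_mult)
  finally have expo: "exp (- ceil_frac (real n * x) * deriv (rate \<alpha>) x) * exp (- real n * rate \<alpha> x) = f ^ k0 / z ^ n" .
  have one: "1 - exp (- deriv (rate \<alpha>) x) = 1 - f" using f by (simp add: I')
  have curv: "z * sqrt (2 * pi * \<bar>deriv (deriv (h \<alpha> x)) z\<bar>) = sqrt (2 * pi * x * v)"
  proof -
    have "\<bar>deriv (deriv (h \<alpha> x)) z\<bar> = x * v / z\<^sup>2"
      unfolding second_deriv_h_saddle[OF x] using x v z by (simp add: abs_mult)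
    thus ?thesis using z by (simp add: real_sqrt_divide real_sqrt_mult)
  qed
  have scale: "term_scale n = Gamma_ratio \<alpha> \<theta> * (real n powr ((1 / \<alpha> - 1) * \<theta> - 1 / 2) / sqrt (2 * pi * x * v)) * x powr (\<theta> / \<alpha> - 1)"
  proof -
    have "real n powr ((1 / \<alpha> - 1) * \<theta> - 1 / 2) = real n powr ((\<theta> / \<alpha> - 1) + (1 - \<theta>) - 1 / 2)"
      by (rule arg_cong[of _ _ "\<lambda>t. real n powr t"]) (simp add: algebra_simps)
    also have "\<dots> = real n powr (\<theta> / \<alpha> - 1) * real n powr (1 - \<theta>) / sqrt (real n)"
      using n by (simp only: powr_add powr_diff powr_half_sqrt of_nat_0_le_iff)
    finally show ?thesis using x n
      by (simp add: term_scale_def powr_mult real_sqrt_mult mult_ac)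
  qed
  show ?thesis
    unfolding tail_approx_def one curv scale k0_def[symmetric] expo[symmetric] by simp
qed

lemma term_scale_nonzero: "n \<ge> 1 \<Longrightarrow> term_scale n \<noteq> 0"
  using Gamma_ratio_nonzero x v by (simp add: term_scale_def)

lemma tail_over_approx:
  assumes n: "n \<ge> 1"
  shows "(\<Sum>k | k \<le> n \<and> x * real n \<le> real k. types_weight \<alpha> \<theta> n k * conv_pow (sibuya \<alpha>) k n) / tail_approx \<alpha> \<theta> x n
    = (1 - f) * (\<Sum>j. f ^ j * (if nat \<lceil>x * real n\<rceil> + j \<le> n then term_ratio n (nat \<lceil>x * real n\<rceil> + j) else 0))"
proof -
  define k0 where "k0 = nat \<lceil>x * real n\<rceil>"
  define g where "g j = f ^ j * (if k0 + j \<le> n then term_ratio n (k0 + j) else 0)" for j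
  have T: "tail_approx \<alpha> \<theta> x n = term_scale n * (f ^ k0 / z ^ n) / (1 - f)"
    unfolding k0_def by (rule tail_approx_eq[OF n])
  have iff: "x * real n \<le> real k \<longleftrightarrow> k0 \<le> k" for k
    unfolding k0_def by (simp add: nat_le_iff ceiling_le_iff)
  have "types_weight \<alpha> \<theta> n k * conv_pow (sibuya \<alpha>) k n / tail_approx \<alpha> \<theta> x n = (1 - f) * g (k - k0)"
    if k: "k0 \<le> k" "k \<le> n" for k
  proof -
    have "f ^ k = f ^ k0 * f ^ (k - k0)" using k by (simp flip: power_add)
    hence conv: "conv_pow (sibuya \<alpha>) k n = f ^ k0 * f ^ (k - k0) * q k n / z ^ n"
      using conv_pow_tilted[of \<alpha> z k n] f z by (simp add: field_simps)
    show ?thesis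
      unfolding T conv g_def term_ratio_def using k f z term_scale_nonzero[OF n] by simp
  qed
  hence "(\<Sum>k | k \<le> n \<and> x * real n \<le> real k. types_weight \<alpha> \<theta> n k * conv_pow (sibuya \<alpha>) k n) / tail_approx \<alpha> \<theta> x n
      = (\<Sum>k | k \<le> n \<and> k0 \<le> k. (1 - f) * g (k - k0))"
    unfolding sum_divide_distrib iff by (intro sum.cong) auto
  also have "\<dots> = (\<Sum>j | k0 + j \<le> n. (1 - f) * g j)"
    by (rule sum.reindex_bij_witness[of _ "\<lambda>j. k0 + j" "\<lambda>k. k - k0"]) auto
  also have "\<dots> = (1 - f) * (\<Sum>j | k0 + j \<le> n. g j)" by (simp add: sum_distrib_left)
  also have "(\<Sum>j | k0 + j \<le> n. g j) = (\<Sum>j. g j)"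
  proof (rule suminf_finite[symmetric])
    show "finite {j. k0 + j \<le> n}" by (rule finite_subset[of _ "{..n}"]) auto
  qed (auto simp: g_def)
  finally show ?thesis unfolding g_def k0_def .
qed

text \<open>Terms with \<open>k > n\<close> are absent from the sum but present in the geometric series. There
  \<open>k - xn \<ge> (1 - x) n\<close>, so an error of size 1 is still \<open>O((1 + j) / n)\<close>.\<close>

theorem tail_asymptotics:
  "\<exists>C. \<forall>n\<ge>1. \<bar>(\<Sum>k | k \<le> n \<and> x * real n \<le> real k. types_weight \<alpha> \<theta> n k * conv_pow (sibuya \<alpha>) k n)
      / tail_approx \<alpha> \<theta> x n - 1\<bar> \<le> C / real n"
proof -
  obtain C where C: "C \<ge> 0" "\<And>n k j. n \<ge> 1 \<Longrightarrow> k \<le> n \<Longrightarrow> x * real n \<le> real k \<Longrightarrow> real k \<le> x * real n + (1 + real j) \<Longrightarrow>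
     \<bar>term_ratio n k - 1\<bar> \<le> C * (1 + real j)\<^sup>2 / real n"
    using term_ratio_error by blast
  define e where "e n j = (if nat \<lceil>x * real n\<rceil> + j \<le> n then term_ratio n (nat \<lceil>x * real n\<rceil> + j) else 0)" for n j
  define D where "D = max C (1 / (1 - x))"
  have "\<bar>e n j - 1\<bar> \<le> D * (1 + real j)\<^sup>2 / real n" if n: "n \<ge> 1" for n j
  proof -
    define k0 where "k0 = nat \<lceil>x * real n\<rceil>"
    have pos: "0 \<le> x * real n" using x by simp
    have k0: "x * real n \<le> real k0" "real k0 \<le> x * real n + 1"
      using pos ceiling_correct[of "x * real n"] by (auto simp: k0_def)
    show ?thesis
    proof (cases "k0 + j \<le> n")
      case True
      hence "\<bar>e n j - 1\<bar> \<le> C * (1 + real j)\<^sup>2 / real n"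
        using C(2)[OF n True, of j] k0 by (simp add: e_def k0_def[symmetric])
      also have "\<dots> \<le> D * (1 + real j)\<^sup>2 / real n"
        by (intro divide_right_mono mult_right_mono) (auto simp: D_def)
      finally show ?thesis .
    next
      case False
      hence "real n \<le> real k0 + real j" by linarith
      hence "(1 - x) * real n \<le> 1 + real j" using k0 by (simp add: algebra_simps)
      also have "1 + real j \<le> (1 + real j)\<^sup>2" by (simp add: power2_eq_square)
      finally have "1 \<le> 1 / (1 - x) * (1 + real j)\<^sup>2 / real n" using x n by (simp add: field_simps)
      also have "\<dots> \<le> D * (1 + real j)\<^sup>2 / real n"
        by (intro divide_right_mono mult_right_mono) (auto simp: D_def)
      finally show ?thesis using False by (simp add: e_def k0_def)
    qed
  qed
  from geometric_average_error[OF f this] show ?thesis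
    unfolding e_def using tail_over_approx by simp
qed

end

theorem theorem1p1:
  fixes \<alpha> \<theta> x :: real
    and P :: "nat \<Rightarrow> 'w measure"
    and X :: "nat \<Rightarrow> nat \<Rightarrow> 'w \<Rightarrow> 'c"
  assumes "0 < \<alpha>" and "\<alpha> < 1"
    and "\<theta> > - \<alpha>"
    and "0 < x" and "x < 1"
    and "\<And>n. n \<ge> 1 \<Longrightarrow> ewens_pitman_sample \<alpha> \<theta> n (P n) (X n)"
  shows "\<exists>C. \<forall>n\<ge>1.
    \<bar>measure (P n) {\<omega> \<in> space (P n). real (num_types n (\<lambda>i. X n i \<omega>)) \<ge> x * real n}
       / tail_approx \<alpha> \<theta> x n - 1\<bar> \<le> C * \<bar>(1 / x) * (1 / real n)\<bar>"
proof -
  interpret ewens_pitman_tail \<alpha> \<theta> x using assms by unfold_locales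
  obtain C where C: "\<And>n. n \<ge> 1 \<Longrightarrow>
      \<bar>(\<Sum>k | k \<le> n \<and> x * real n \<le> real k. types_weight \<alpha> \<theta> n k * conv_pow (sibuya \<alpha>) k n)
        / tail_approx \<alpha> \<theta> x n - 1\<bar> \<le> C / real n"
    using tail_asymptotics by blast
  have "\<bar>measure (P n) {\<omega> \<in> space (P n). real (num_types n (\<lambda>i. X n i \<omega>)) \<ge> x * real n}
       / tail_approx \<alpha> \<theta> x n - 1\<bar> \<le> (C * x) * \<bar>(1 / x) * (1 / real n)\<bar>" if "n \<ge> 1" for n
    using C[OF that] measure_num_types_ge[OF assms(1) assms(6)[OF that], of "x * real n"] assms(4) by simp
  thus ?thesis by blast
qed

end
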